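(* For any $\lambda$ with $0<\lambda<1$, the Fredholm determinant $\beta\mapsto\det(1-\lambda\mathcal{L}_\beta)$ has infinitely many zeros $\beta$ on the real line $\mathbb{R}$. For $\lambda=\frac12$ there are infinitely many zeros $\beta\in\mathbb{C}$ of $\det(1-\lambda\mathcal{L}_\beta)$ on the line $\mathrm{Re}(\beta)=\ln 2$.
   Context: For $0<\lambda<1$ and $\beta\in\mathbb{C}$, the Ruelle operator $\mathcal{L}_\beta$ is $$(\mathcal{L}_\beta g)(z)=e^{\beta z}g(\lambda+\lambda z)+e^{-\beta z}g(-\lambda+\lambda z),$$ acting on the Banach space $B(D_r)$ of functions holomorphic in the disc $D_r=\{z\in\mathbb{C}:|z|<r\}$ and continuous on $\overline{D_r}$, with the supremum norm, where $r>\frac{\lambda}{1-\lambda}$. For every $\beta\in\mathbb{C}$ this operator is nuclear in the sense of Grothendieck, and its Fredholm determinant $\det(1-z\mathcal{L}_\beta)$ is an entire function of both $z$ and $\beta$, whose zeros in $z$ are the reciprocals of the nonzero eigenvalues of $\mathcal{L}_\beta$. *)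

theory Defs
  imports "HOL-Complex_Analysis.Complex_Analysis" "Jordan_Normal_Form.Determinant"
begin

(* The space B(D_r). Elements are total functions, of which only the values on the closed disc
   matter: disc_norm is a seminorm that vanishes exactly on the functions that vanish on the
   closed disc, so bounded linear functionals do not see the values outside the disc. *)
definition disc_space :: "real \<Rightarrow> (complex \<Rightarrow> complex) set" where
  "disc_space r = {g. g holomorphic_on ball 0 r \<and> continuous_on (cball 0 r) g}"

definition disc_norm :: "real \<Rightarrow> (complex \<Rightarrow> complex) \<Rightarrow> real" where
  "disc_norm r g = (SUP z\<in>cball 0 r. norm (g z))"

definition disc_dual :: "real \<Rightarrow> ((complex \<Rightarrow> complex) \<Rightarrow> complex) set" where
  "disc_dual r = {\<phi>.
     (\<forall>g\<in>disc_space r. \<forall>h\<in>disc_space r. \<phi> (\<lambda>z. g z + h z) = \<phi> g + \<phi> h) \<and>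
     (\<forall>c. \<forall>g\<in>disc_space r. \<phi> (\<lambda>z. c * g z) = c * \<phi> g) \<and>
     (\<exists>C. \<forall>g\<in>disc_space r. norm (\<phi> g) \<le> C * disc_norm r g)}"

definition disc_dual_norm :: "real \<Rightarrow> ((complex \<Rightarrow> complex) \<Rightarrow> complex) \<Rightarrow> real" where
  "disc_dual_norm r \<phi> = (SUP g\<in>{g \<in> disc_space r. disc_norm r g \<le> 1}. norm (\<phi> g))"

(* Grothendieck's nuclear representations T g = sum_k phi_k(g) f_k, the series converging in norm
   for every g, with sum_k |phi_k| |f_k| finite; T is nuclear iff it has one. *)
definition nuclear_rep ::
  "real \<Rightarrow> ((complex \<Rightarrow> complex) \<Rightarrow> complex \<Rightarrow> complex) \<Rightarrow>
   (nat \<Rightarrow> (complex \<Rightarrow> complex) \<Rightarrow> complex) \<Rightarrow> (nat \<Rightarrow> complex \<Rightarrow> complex) \<Rightarrow> bool" where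
  "nuclear_rep r T \<phi> f \<longleftrightarrow>
     (\<forall>k. \<phi> k \<in> disc_dual r) \<and> (\<forall>k. f k \<in> disc_space r) \<and>
     summable (\<lambda>k. disc_dual_norm r (\<phi> k) * disc_norm r (f k)) \<and>
     (\<forall>g\<in>disc_space r.
        (\<lambda>N. disc_norm r (\<lambda>z. T g z - (\<Sum>k<N. \<phi> k g * f k z))) \<longlonglongrightarrow> 0)"

(* Fredholm's series
     det(1 - z T) = sum_n (-z)^n / n! sum_(i_1,...,i_n) det (phi_(i_a) (f_(i_b)))_(a,b=1..n)
   attached to a nuclear representation. By Hadamard's inequality the inner sums converge
   absolutely and the outer one converges for every z. *)
definition fredholm_series ::
  "(nat \<Rightarrow> (complex \<Rightarrow> complex) \<Rightarrow> complex) \<Rightarrow> (nat \<Rightarrow> complex \<Rightarrow> complex) \<Rightarrow> complex \<Rightarrow> complex"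
  where
  "fredholm_series \<phi> f z =
     (\<Sum>n. (- z) ^ n / fact n *
        (\<Sum>\<^sub>\<infinity>i\<in>{..<n} \<rightarrow>\<^sub>E UNIV. Determinant.det (mat n n (\<lambda>(a, b). \<phi> (i a) (f (i b))))))"

(* fredholm_det r T z is det(1 - z T) for a nuclear operator T on B(D_r). Since B(D_r) has the
   approximation property, the series is the same for all nuclear representations of T, so it
   does not matter which one is chosen. *)
definition fredholm_det ::
  "real \<Rightarrow> ((complex \<Rightarrow> complex) \<Rightarrow> complex \<Rightarrow> complex) \<Rightarrow> complex \<Rightarrow> complex" where
  "fredholm_det r T z =
     (case (SOME (\<phi>, f). nuclear_rep r T \<phi> f) of (\<phi>, f) \<Rightarrow> fredholm_series \<phi> f z)"

definition ruelle_op ::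
  "real \<Rightarrow> complex \<Rightarrow> (complex \<Rightarrow> complex) \<Rightarrow> complex \<Rightarrow> complex" where
  "ruelle_op l \<beta> g = (\<lambda>z. exp (\<beta> * z) * g (of_real l + of_real l * z)
                           + exp (- \<beta> * z) * g (- of_real l + of_real l * z))"

end

(* Any nuclear representation sum_k phi_k f_k turns an eigenfunction g into an eigenvector
   x_k = phi_k(g) of the infinite matrix phi_j(f_k). Border the minors of the Fredholm series by a row p
   and the column x: the sums of these bordered minors satisfy a recurrence by which the partial sums of the
   series at 1/mu, times x_p, are the general term of a null sequence. So the determinant vanishes at the
   reciprocal of an eigenvalue.

   For l = 1/2 the function exp(2 b z) - exp(-2 b z) is an eigenfunction with eigenvalue exp b, which equals
   2 for infinitely many b with Re b = ln 2.

   For real t > 0 the Ruelle operator is a product of two positive operators on a Fock space. The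
   truncations of the quadratic form attached to the eigenvalue 1/l have positive index bounded for each
   fixed t, uniformly in the truncation, but unbounded as t grows. So on some interval [a, b], with a
   arbitrarily large, every large truncation degenerates at some t, and a Montel limit of the
   kernel polynomials is an eigenfunction with eigenvalue 1/l. *)

theory Submission
  imports Defs "HOL-Real_Asymp.Real_Asymp"
begin

section \<open>Fredholm series of nuclear matrices\<close>

text \<open>\<open>fredholm_det\<close> rests on an unspecified nuclear representation, so the
  passage from eigenvalue to zero has to work for all of them. Only this direction occurs: each zero
  at \<open>l\<close> comes from an eigenvalue \<open>1 / l\<close>. A product of two positive
  operators is not symmetric, so inertia cannot follow its eigenvalues directly. Writing the
  eigenvector as the preimage of y under the dilation S turns the equation into
  \<open>P y = (1 / l) S^-1 y\<close>, a symmetric pencil that can be studied in finite degree.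
  There inertia is elementary, but the degenerate parameter depends on the degree: it might escape
  to infinity, and the kernel polynomials might tend to zero. The first is excluded by an interval
  fixed before the degree, which is why the index bound at its left end must be uniform. The second
  is excluded by the operator itself, which on the closed disc reads its argument only on a strictly
  smaller closed disc. The same contraction yields nuclearity, the truncation error and continuity
  of the limit up to the boundary.\<close>

lemma norm_det_le:
  fixes F :: "nat \<Rightarrow> nat \<Rightarrow> complex"
  assumes F: "\<And>i j. i < n \<Longrightarrow> j < n \<Longrightarrow> norm (F i j) \<le> \<alpha> i * \<gamma> j"
  shows "norm (Determinant.det (mat n n (\<lambda>(i, j). F i j))) \<le> fact n * (\<Prod>i<n. \<alpha> i) * (\<Prod>j<n. \<gamma> j)"
proof -
  let ?P = "{p. p permutes {0..<n}}"
  have "norm (Determinant.det (mat n n (\<lambda>(i, j). F i j)))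
      = norm (\<Sum>p\<in>?P. of_int (sign p) * (\<Prod>i = 0..<n. F i (p i)))"
    by (subst det_def'[of _ n]) (auto intro!: arg_cong[where f = norm] sum.cong prod.cong
        dest: permutes_in_image[where x = "_ :: nat"])
  also have "\<dots> \<le> (\<Sum>p\<in>?P. (\<Prod>i<n. \<alpha> i) * (\<Prod>j<n. \<gamma> j))"
  proof (rule sum_norm_le)
    fix p assume "p \<in> ?P"
    then have p: "p permutes {0..<n}" by simp
    have "norm (of_int (sign p) * (\<Prod>i = 0..<n. F i (p i))) = (\<Prod>i = 0..<n. norm (F i (p i)))"
      by (simp add: norm_mult prod_norm sign_def)
    also have "\<dots> \<le> (\<Prod>i = 0..<n. \<alpha> i * \<gamma> (p i))"
      using F permutes_in_image[OF p] by (intro prod_mono) auto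
    also have "\<dots> = (\<Prod>i = 0..<n. \<alpha> i) * (\<Prod>j = 0..<n. \<gamma> j)"
      by (simp add: prod.distrib prod.permute[OF p, of \<gamma>] o_def)
    finally show "norm (of_int (sign p) * (\<Prod>i = 0..<n. F i (p i))) \<le> (\<Prod>i<n. \<alpha> i) * (\<Prod>j<n. \<gamma> j)"
      by (simp add: atLeast0LessThan)
  qed
  also have "\<dots> = fact n * (\<Prod>i<n. \<alpha> i) * (\<Prod>j<n. \<gamma> j)"
    by (simp add: card_permutations mult.assoc)
  finally show ?thesis .
qed

section \<open>Reindexed determinants and bordered minors\<close>

lemma det_mat_permute_both:
  fixes F :: "nat \<Rightarrow> nat \<Rightarrow> 'a :: comm_ring_1"
  assumes p: "p permutes {0..<n}"
  shows "Determinant.det (mat n n (\<lambda>(i, j). F (p i) (p j))) = Determinant.det (mat n n (\<lambda>(i, j). F i j))"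
proof -
  have p_less: "i < n \<Longrightarrow> p i < n" for i
    using permutes_in_image[OF p, of i] by simp
  have rows: "Determinant.det (mat n n (\<lambda>(i, j). H (p i) j))
      = of_int (sign p) * Determinant.det (mat n n (\<lambda>(i, j). H i j))" for H :: "nat \<Rightarrow> nat \<Rightarrow> 'a"
  proof -
    have "mat n n (\<lambda>(i, j). H (p i) j) = mat n n (\<lambda>(i, j). mat n n (\<lambda>(i, j). H i j) $$ (p i, j))"
      using p_less by (intro eq_matI) auto
    then show ?thesis using det_permute_rows[OF _ p, of "mat n n (\<lambda>(i, j). H i j)"] by simp
  qed
  have tr: "Determinant.det (mat n n (\<lambda>(i, j). H i j)) = Determinant.det (mat n n (\<lambda>(i, j). H j i))"
    for H :: "nat \<Rightarrow> nat \<Rightarrow> 'a"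
    by (subst det_transpose[of _ n, symmetric]) (auto intro!: arg_cong[where f = Determinant.det] eq_matI)
  have "Determinant.det (mat n n (\<lambda>(i, j). F (p i) (p j)))
      = of_int (sign p) * Determinant.det (mat n n (\<lambda>(i, j). F i (p j)))"
    by (rule rows)
  also have "Determinant.det (mat n n (\<lambda>(i, j). F i (p j))) = Determinant.det (mat n n (\<lambda>(i, j). F j (p i)))"
    by (rule tr)
  also have "\<dots> = of_int (sign p) * Determinant.det (mat n n (\<lambda>(i, j). F j i))"
    by (rule rows)
  also have "Determinant.det (mat n n (\<lambda>(i, j). F j i)) = Determinant.det (mat n n (\<lambda>(i, j). F i j))"
    by (rule tr)
  finally show ?thesis by (simp add: sign_def)
qed

lemma det_mat_eq_columns:
  fixes F :: "nat \<Rightarrow> nat \<Rightarrow> 'a :: comm_ring_1"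
  assumes "c < n" "d < n" "c \<noteq> d" and F: "\<And>i. i < n \<Longrightarrow> F i c = F i d"
  shows "Determinant.det (mat n n (\<lambda>(i, j). F i j)) = 0"
  by (rule det_identical_columns[of _ n c d]) (use assms in \<open>auto intro!: eq_vecI\<close>)

text \<open>The border column \<open>y\<close> is indexed by row position, not by matrix index. Thus
  it can be the eigenvector, another column of \<open>A\<close>, or a unit vector that singles out
  one minor; all three occur.\<close>

definition bord :: "(nat \<Rightarrow> nat \<Rightarrow> complex) \<Rightarrow> (nat \<Rightarrow> nat) \<Rightarrow> nat \<Rightarrow> nat \<Rightarrow> (nat \<Rightarrow> complex) \<Rightarrow> complex"
  where "bord A i p n y =
    Determinant.det (mat (Suc n) (Suc n) (\<lambda>(c, d). if d < n then A ((i(n := p)) c) (i d) else y c))"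

definition minor :: "(nat \<Rightarrow> nat \<Rightarrow> complex) \<Rightarrow> (nat \<Rightarrow> nat) \<Rightarrow> nat \<Rightarrow> nat \<Rightarrow> nat \<Rightarrow> complex"
  where "minor A i p n a =
    Determinant.det (mat n n (\<lambda>(c, d). A ((i(n := p)) (if c < a then c else Suc c)) (i d)))"

lemma bord_laplace: "bord A i p n y = (\<Sum>a<Suc n. y a * ((-1) ^ (a + n) * minor A i p n a))"
proof -
  let ?M = "mat (Suc n) (Suc n) (\<lambda>(c, d). if d < n then A ((i(n := p)) c) (i d) else y c)"
  have "bord A i p n y = (\<Sum>a<Suc n. ?M $$ (a, n) * cofactor ?M a n)"
    unfolding bord_def by (rule laplace_expansion_column) auto
  also have "\<dots> = (\<Sum>a<Suc n. y a * ((-1) ^ (a + n) * minor A i p n a))"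
    unfolding cofactor_def minor_def
    by (intro sum.cong refl arg_cong2[where f = "(*)"] arg_cong[where f = Determinant.det])
       (auto simp: mat_delete_def intro!: eq_matI)
  finally show ?thesis .
qed

lemma minor_last: "minor A i p n n = Determinant.det (mat n n (\<lambda>(c, d). A (i c) (i d)))"
  unfolding minor_def by (intro arg_cong[where f = Determinant.det] eq_matI) auto

text \<open>Deleting row \<open>m\<close> removes \<open>k\<close> as a row index while column
  \<open>k\<close> stays, now in the role of the border. So \<open>k\<close> occurs only once, and a
  sum over \<open>k\<close> weighted by \<open>x k\<close> is a matrix-vector product.\<close>

lemma minor_penultimate:
  "minor A (i(m := k)) p (Suc m) m = bord A i p m (\<lambda>c. A ((i(m := p)) c) k)"
  unfolding minor_def bord_def
  by (intro arg_cong[where f = Determinant.det] eq_matI) (auto simp: less_Suc_eq)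

text \<open>A signed minor is a determinant bordered by a unit column. Exchanging positions
  \<open>a\<close> and \<open>m\<close> in rows and columns together costs no sign, so the minus
  sign is just \<open>(-1) ^ (m + Suc m)\<close>.\<close>

lemma minor_symmetric:
  assumes "a \<le> m"
  shows "(-1) ^ (a + Suc m) * minor A i p (Suc m) a = - minor A (i \<circ> Transposition.transpose a m) p (Suc m) m"
proof -
  let ?t = "Transposition.transpose a m"
  define F where "F c d = (if d < Suc m then A ((i(Suc m := p)) c) (i d) else of_bool (c = a))" for c d
  have perm: "?t permutes {0..<Suc (Suc m)}"
    using assms by (intro permutes_swap_id) auto
  have "(-1) ^ (a + Suc m) * minor A i p (Suc m) a = bord A i p (Suc m) (\<lambda>c. of_bool (c = a))"
    using assms unfolding bord_laplace by (subst sum.remove[of _ a]) auto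
  also have "\<dots> = Determinant.det (mat (Suc (Suc m)) (Suc (Suc m)) (\<lambda>(c, d). F c d))"
    unfolding bord_def F_def ..
  also have "\<dots> = Determinant.det (mat (Suc (Suc m)) (Suc (Suc m)) (\<lambda>(c, d). F (?t c) (?t d)))"
    using det_mat_permute_both[OF perm, of F] by simp
  also have "\<dots> = bord A (i \<circ> ?t) p (Suc m) (\<lambda>c. of_bool (c = m))"
    unfolding bord_def F_def using assms
    by (intro arg_cong[where f = Determinant.det] eq_matI)
       (auto simp: Transposition.transpose_def)
  also have "\<dots> = - minor A (i \<circ> ?t) p (Suc m) m"
    unfolding bord_laplace by (subst sum.remove[of _ m]) auto
  finally show ?thesis .
qed

section \<open>Sums over index tuples\<close>

lemma has_sum_sum:
  fixes f :: "'a \<Rightarrow> 'b \<Rightarrow> 'c :: topological_comm_monoid_add"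
  assumes "\<And>q. q \<in> Q \<Longrightarrow> (f q has_sum s q) B"
  shows "((\<lambda>y. \<Sum>q\<in>Q. f q y) has_sum sum s Q) B"
  using assms by (induction Q rule: infinite_finite_induct) (auto intro!: has_sum_0 has_sum_add)

lemma prod_PiE_nonneg:
  fixes t :: "nat \<Rightarrow> real"
  assumes t: "summable t" "\<And>k. 0 \<le> t k"
  shows "((\<lambda>i. \<Prod>c<n. t (i c)) has_sum (suminf t) ^ n) ({..<n} \<rightarrow>\<^sub>E UNIV)"
proof -
  have abs: "(\<lambda>k. norm (t k)) summable_on UNIV"
    using t by (simp add: norm_summable_imp_summable_on summable_norm_cancel)
  have inf: "infsum t UNIV = suminf t"
    using t by (intro infsumI norm_summable_imp_has_sum) (auto simp: summable_sums)
  have eq: "(\<Sum>\<^sub>\<infinity>i\<in>{..<n} \<rightarrow>\<^sub>E UNIV. \<Prod>c<n. t (i c)) = suminf t ^ n"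
    using infsum_prod_PiE_abs[of "{..<n}" "\<lambda>_. t" "\<lambda>_. UNIV"] abs by (simp add: inf)
  show ?thesis
  proof (cases "n = 0 \<or> suminf t \<noteq> 0")
    case True
    then have "suminf t ^ n \<noteq> 0" by auto
    \<comment> \<open>\<open>infsum\<close> is 0 on families that are not summable, so a nonzero
      value certifies summability.\<close>
    then have "(\<lambda>i. \<Prod>c<n. t (i c)) summable_on ({..<n} \<rightarrow>\<^sub>E UNIV)"
      using eq infsum_not_exists by metis
    then show ?thesis using eq has_sum_infsum by fastforce
  next
    case False
    then have "t k = 0" for k using suminf_eq_zero_iff[OF t] by simp
    then show ?thesis using False by (auto intro!: has_sum_0 simp: power_0_left)
  qed
qed

text \<open>An injective tuple has at most \<open>m\<close> entries below \<open>m\<close>, so at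
  most \<open>m\<close> factors \<open>\<theta>\<close> appear, whatever \<open>n\<close>
  is.\<close>

lemma prod_inj_le:
  fixes t :: "nat \<Rightarrow> real" and i :: "nat \<Rightarrow> nat"
  assumes t: "\<And>k. 0 \<le> t k" and \<theta>: "0 < \<theta>" "\<theta> \<le> 1" and inj: "inj_on i {..<n}"
  shows "(\<Prod>c<n. t (i c)) \<le> (1 / \<theta> ^ m) * (\<Prod>c<n. if i c < m then \<theta> * t (i c) else t (i c))"
proof -
  let ?S = "{c \<in> {..<n}. i c < m}"
  have "card ?S \<le> card {..<m}"
    using inj by (intro card_inj_on_le[of i]) (auto intro: inj_on_subset)
  then have le: "\<theta> ^ m \<le> \<theta> ^ card ?S"
    using \<theta> by (intro power_decreasing) auto
  have "(\<Prod>c<n. if i c < m then \<theta> * t (i c) else t (i c)) = (\<Prod>c<n. (if i c < m then \<theta> else 1) * t (i c))"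
    by (intro prod.cong) auto
  also have "\<dots> = \<theta> ^ card ?S * (\<Prod>c<n. t (i c))"
    unfolding prod.distrib by (subst prod.inter_filter[symmetric]) simp_all
  also have "\<dots> \<ge> \<theta> ^ m * (\<Prod>c<n. t (i c))"
    using le t by (intro mult_right_mono prod_nonneg) auto
  finally show ?thesis using \<theta> by (simp add: field_simps)
qed

text \<open>On injective index tuples only boundedly many factors come from any finite part of \<open>t\<close>, so
  that part can be scaled down at the cost of a constant. This replaces Hadamard's inequality.\<close>

lemma inj_domination:
  fixes t :: "nat \<Rightarrow> real"
  assumes t: "summable t" "\<And>k. 0 \<le> t k" and \<epsilon>: "0 < \<epsilon>"
  obtains t' K where "summable t'" "\<And>k. 0 \<le> t' k" "suminf t' \<le> \<epsilon>" "0 \<le> K"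
    "\<And>(n::nat) i. inj_on i {..<n} \<Longrightarrow> (\<Prod>c<n. t (i c)) \<le> K * (\<Prod>c<n. t' (i c))"
proof -
  obtain m where m: "norm (\<Sum>k. t (k + m)) < \<epsilon> / 2"
    using suminf_exist_split[of "\<epsilon> / 2" t] t \<epsilon> by auto
  \<comment> \<open>The tail beyond \<open>m\<close> takes half of \<open>\<epsilon>\<close>;
    \<open>\<theta>\<close> shrinks the head to the other half. Adding 1 keeps the denominator
    positive when the sum is 0.\<close>
  define \<theta> where "\<theta> = min 1 (\<epsilon> / (2 * (suminf t + 1)))"
  have S: "0 \<le> suminf t" using t by (simp add: suminf_nonneg)
  have \<theta>: "0 < \<theta>" "\<theta> \<le> 1" using \<epsilon> S unfolding \<theta>_def by auto
  define t' where "t' k = (if k < m then \<theta> * t k else t k)" for k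
  have t'0: "0 \<le> t' k" for k using \<theta> t unfolding t'_def by auto
  have sm: "summable t'"
    using t \<theta> by (intro summable_comparison_test[OF _ t(1)] exI[of _ 0])
      (auto simp: t'_def intro: mult_left_le_one_le)
  have "suminf t' = (\<Sum>k. t' (k + m)) + (\<Sum>k<m. t' k)"
    by (rule suminf_split_initial_segment[OF sm])
  also have "(\<Sum>k. t' (k + m)) = (\<Sum>k. t (k + m))" unfolding t'_def by simp
  also have "(\<Sum>k<m. t' k) = \<theta> * (\<Sum>k<m. t k)" unfolding t'_def by (simp add: sum_distrib_left)
  also have "\<theta> * (\<Sum>k<m. t k) \<le> \<epsilon> / (2 * (suminf t + 1)) * (suminf t + 1)"
  proof (rule mult_mono)
    show "(\<Sum>k<m. t k) \<le> suminf t + 1" using sum_le_suminf[OF t(1), of "{..<m}"] t by auto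
  qed (use \<epsilon> S t in \<open>auto simp: \<theta>_def intro: sum_nonneg\<close>)
  also have "\<dots> = \<epsilon> / 2" using S by (simp add: field_simps)
  finally have le: "suminf t' \<le> \<epsilon>" using m by simp
  show thesis
  proof (rule that[OF sm t'0 le])
    show "(\<Prod>c<n. t (i c)) \<le> (1 / \<theta> ^ m) * (\<Prod>c<n. t' (i c))" if "inj_on i {..<n}" for n :: nat and i
      using prod_inj_le[OF t(2) \<theta> that, where m = m] unfolding t'_def by simp
  qed (use \<theta> in auto)
qed

text \<open>Abstracts the matrix phi_j(f_k) of a nuclear representation, with \<open>a\<close> and
  \<open>b\<close> the norms of the functionals and of the functions.\<close>

locale nuclear_matrix =
  fixes A :: "nat \<Rightarrow> nat \<Rightarrow> complex" and a b :: "nat \<Rightarrow> real"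
  assumes nonneg: "\<And>k. 0 \<le> a k" "\<And>k. 0 \<le> b k"
    and summable_ab: "summable (\<lambda>k. a k * b k)"
    and bound: "\<And>j k. norm (A j k) \<le> a j * b k"
begin

lemma ab_nonneg: "0 \<le> a k * b k"
  using nonneg by simp

definition pminor :: "(nat \<Rightarrow> nat) \<Rightarrow> nat \<Rightarrow> complex"
  where "pminor i n = Determinant.det (mat n n (\<lambda>(c, d). A (i c) (i d)))"

lemma norm_pminor_le:
  "norm (pminor i n) \<le> fact n * (\<Prod>c<n. a (i c) * b (i c))"
  unfolding pminor_def prod.distrib mult.assoc[symmetric]
  by (rule norm_det_le) (rule bound)

definition trace_term :: "nat \<Rightarrow> complex"
  where "trace_term n = (\<Sum>\<^sub>\<infinity>i\<in>{..<n} \<rightarrow>\<^sub>E UNIV. pminor i n)"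

lemma dominated_summable:
  fixes f :: "(nat \<Rightarrow> nat) \<Rightarrow> complex"
  assumes f: "\<And>i. norm (f i) \<le> C * (\<Prod>c<n. t (i c))"
    and t: "summable t" "\<And>k. 0 \<le> t k"
  shows "f summable_on ({..<n} \<rightarrow>\<^sub>E UNIV)"
    and "norm (infsum f ({..<n} \<rightarrow>\<^sub>E UNIV)) \<le> C * suminf t ^ n"
proof -
  have hs: "((\<lambda>i. C * (\<Prod>c<n. t (i c))) has_sum C * suminf t ^ n) ({..<n} \<rightarrow>\<^sub>E UNIV)"
    by (rule has_sum_cmult_right[OF prod_PiE_nonneg[OF t]])
  show "f summable_on ({..<n} \<rightarrow>\<^sub>E UNIV)"
    by (rule Infinite_Sum.abs_summable_summable[OF Infinite_Sum.abs_summable_on_comparison_test'[OF has_sum_imp_summable[OF hs] f]])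
  show "norm (infsum f ({..<n} \<rightarrow>\<^sub>E UNIV)) \<le> C * suminf t ^ n"
    by (rule norm_infsum_le[OF _ hs]) (use \<open>f summable_on _\<close> f in \<open>auto intro: has_sum_infsum\<close>)
qed
end

text \<open>Here \<open>x k\<close> stands for phi_k(g) and \<open>G\<close> for the norm of the
  eigenfunction g.\<close>

locale nuclear_eigenvector = nuclear_matrix +
  fixes x :: "nat \<Rightarrow> complex" and G :: real and \<mu> :: complex
  assumes x_le: "\<And>k. norm (x k) \<le> a k * G" and G: "0 \<le> G"
    and eigen: "\<And>j. ((\<lambda>k. A j k * x k) has_sum \<mu> * x j) UNIV"
begin

definition xminor :: "nat \<Rightarrow> (nat \<Rightarrow> nat) \<Rightarrow> nat \<Rightarrow> complex"
  where "xminor p i n = bord A i p n (\<lambda>c. x ((i(n := p)) c))"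

definition xtrace_term :: "nat \<Rightarrow> nat \<Rightarrow> complex"
  where "xtrace_term p n = (\<Sum>\<^sub>\<infinity>i\<in>{..<n} \<rightarrow>\<^sub>E UNIV. xminor p i n)"

lemma norm_xminor_le:
  "norm (xminor p i n) \<le> fact (Suc n) * a p * G * (\<Prod>c<n. a (i c) * b (i c))"
proof -
  let ?J = "i(n := p)"
  have "norm (xminor p i n) \<le> fact (Suc n) * (\<Prod>c<Suc n. a (?J c)) * (\<Prod>d<Suc n. if d < n then b (i d) else G)"
    unfolding xminor_def bord_def by (rule norm_det_le) (use bound x_le in auto)
  also have "\<dots> = fact (Suc n) * a p * G * (\<Prod>c<n. a (i c) * b (i c))"
    by (simp add: prod.distrib algebra_simps)
  finally show ?thesis .
qed

text \<open>A repeated index gives two equal columns. This restriction to injective tuples is what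
  makes \<open>inj_domination\<close> applicable.\<close>

lemma xminor_not_inj:
  assumes "\<not> inj_on i {..<n}"
  shows "xminor p i n = 0"
proof -
  obtain c d where "c < n" "d < n" "c \<noteq> d" "i c = i d"
    using assms by (auto simp: inj_on_def)
  then show ?thesis unfolding xminor_def bord_def by (intro det_mat_eq_columns[of c _ d]) auto
qed

text \<open>Deleting row \<open>q\<close> loses the factor \<open>a (i q)\<close>, and
  \<open>x (i q)\<close> supplies it again. Hence every index keeps a full factor
  \<open>a * b\<close> and the sum over tuples converges.\<close>

lemma norm_minor_le:
  assumes "q < n"
  shows "norm (x (i q) * minor A i p n q) \<le> (G * fact n * a p) * (\<Prod>c<n. a (i c) * b (i c))"
proof -
  define h where "h c = (if c < q then c else Suc c)" for c
  let ?J = "\<lambda>c. (i(n := p)) (h c)"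
  have *: "a (i q) * (\<Prod>c<n. a (?J c)) = a p * (\<Prod>c<n. a (i c))"
  proof -
    have "{..<Suc n} = insert q (h ` {..<n})"
    proof (intro equalityI subsetI)
      fix c assume c: "c \<in> {..<Suc n}"
      show "c \<in> insert q (h ` {..<n})"
      proof (cases c q rule: linorder_cases)
        case less
        then show ?thesis using assms by (auto intro!: image_eqI[of _ _ c] simp: h_def)
      next
        case greater
        then show ?thesis using c by (auto intro!: image_eqI[of _ _ "c - 1"] simp: h_def)
      qed simp
    qed (use assms in \<open>auto simp: h_def split: if_splits\<close>)
    moreover have "inj_on h {..<n}"
      by (auto simp: h_def inj_on_def split: if_splits)
    moreover have "q \<notin> h ` {..<n}" by (auto simp: h_def)
    ultimately have "(\<Prod>c<Suc n. a ((i(n := p)) c)) = a ((i(n := p)) q) * (\<Prod>c<n. a (?J c))"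
      by (simp add: prod.reindex o_def del: fun_upd_apply prod.lessThan_Suc)
    then show ?thesis using assms by (simp add: mult.commute)
  qed
  have "norm (minor A i p n q) \<le> fact n * (\<Prod>c<n. a (?J c)) * (\<Prod>d<n. b (i d))"
    unfolding minor_def h_def by (rule norm_det_le) (use bound in auto)
  then have "norm (x (i q) * minor A i p n q) \<le> (a (i q) * G) * (fact n * (\<Prod>c<n. a (?J c)) * (\<Prod>d<n. b (i d)))"
    unfolding norm_mult using x_le G nonneg by (intro mult_mono) auto
  also have "\<dots> = (G * fact n) * (a (i q) * (\<Prod>c<n. a (?J c))) * (\<Prod>d<n. b (i d))"
    by simp
  also have "\<dots> = (G * fact n * a p) * (\<Prod>c<n. a (i c) * b (i c))"
    unfolding * by (simp add: prod.distrib)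
  finally show ?thesis .
qed

lemma xminor_expand:
  "xminor p i (Suc m) = x p * pminor i (Suc m)
     + (\<Sum>q<Suc m. x (i q) * ((-1) ^ (q + Suc m) * minor A i p (Suc m) q))"
  unfolding xminor_def bord_laplace by (subst sum.lessThan_Suc) (simp add: minor_last pminor_def)

lemma xminor_0: "xminor p i 0 = x p"
  unfolding xminor_def bord_laplace by (simp add: minor_last)

text \<open>The last index occurs only in the border column, which depends linearly on it. Summing
  it against \<open>x\<close> replaces that column by \<open>\<mu> * x\<close>, by the eigenvalue
  equation.\<close>

lemma infsum_last_minor:
  "(\<Sum>\<^sub>\<infinity>i\<in>{..<Suc m} \<rightarrow>\<^sub>E UNIV. x (i m) * minor A i p (Suc m) m) = \<mu> * xtrace_term p m"
proof -
  let ?f = "\<lambda>i. x (i m) * minor A i p (Suc m) m"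
  let ?g = "\<lambda>i k. x k * bord A i p m (\<lambda>c. A ((i(m := p)) c) k)"
  have summ: "?f summable_on ({..<Suc m} \<rightarrow>\<^sub>E UNIV)"
    by (rule dominated_summable(1)[OF norm_minor_le summable_ab ab_nonneg]) auto
  \<comment> \<open>Functions in \<open>PiE\<close> are \<open>undefined\<close> off their domain,
    so the inverse map must restore that value at \<open>m\<close>.\<close>
  have bij: "bij_betw (\<lambda>(i, k). i(m := k)) (({..<m} \<rightarrow>\<^sub>E UNIV) \<times> (UNIV :: nat set)) ({..<Suc m} \<rightarrow>\<^sub>E UNIV)"
    by (rule bij_betw_byWitness[where f' = "\<lambda>i. (i(m := undefined), i m)"])
       (auto simp: PiE_def extensional_def fun_eq_iff)
  have fg: "?f ((\<lambda>(i, k). i(m := k)) z) = (case z of (i, k) \<Rightarrow> ?g i k)" for z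
    by (cases z) (simp add: minor_penultimate)
  have summ2: "(\<lambda>(i, k). ?g i k) summable_on (({..<m} \<rightarrow>\<^sub>E UNIV) \<times> UNIV)"
    using summ unfolding summable_on_reindex_bij_betw[OF bij, symmetric] fg by simp
  have "infsum ?f ({..<Suc m} \<rightarrow>\<^sub>E UNIV) = (\<Sum>\<^sub>\<infinity>(i, k)\<in>({..<m} \<rightarrow>\<^sub>E UNIV) \<times> UNIV. ?g i k)"
    unfolding infsum_reindex_bij_betw[OF bij, symmetric] fg by simp
  also have "\<dots> = (\<Sum>\<^sub>\<infinity>i\<in>{..<m} \<rightarrow>\<^sub>E UNIV. \<Sum>\<^sub>\<infinity>k. ?g i k)"
    by (rule infsum_Sigma'_banach[OF summ2, symmetric])
  also have "\<dots> = (\<Sum>\<^sub>\<infinity>i\<in>{..<m} \<rightarrow>\<^sub>E UNIV. \<mu> * xminor p i m)"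
  proof (rule infsum_cong)
    fix i :: "nat \<Rightarrow> nat"
    let ?J = "i(m := p)"
    have "((\<lambda>k. \<Sum>q<Suc m. ((-1) ^ (q + m) * minor A i p m q) * (A (?J q) k * x k)) has_sum
        (\<Sum>q<Suc m. ((-1) ^ (q + m) * minor A i p m q) * (\<mu> * x (?J q)))) UNIV"
      by (intro has_sum_sum has_sum_cmult_right eigen)
    also have "(\<lambda>k. \<Sum>q<Suc m. ((-1) ^ (q + m) * minor A i p m q) * (A (?J q) k * x k)) = ?g i"
      unfolding bord_laplace sum_distrib_left by (intro ext sum.cong refl) (simp add: mult_ac)
    also have "(\<Sum>q<Suc m. ((-1) ^ (q + m) * minor A i p m q) * (\<mu> * x (?J q))) = \<mu> * xminor p i m"
      unfolding xminor_def bord_laplace sum_distrib_left by (intro sum.cong refl) (simp add: mult_ac)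
    finally show "(\<Sum>\<^sub>\<infinity>k. ?g i k) = \<mu> * xminor p i m" by (rule infsumI)
  qed
  also have "\<dots> = \<mu> * xtrace_term p m"
    unfolding xtrace_term_def by (rule infsum_cmult_right')
  finally show ?thesis .
qed

lemma infsum_any_minor:
  assumes "q \<le> m"
  shows "((\<lambda>i. x (i q) * ((-1) ^ (q + Suc m) * minor A i p (Suc m) q)) has_sum (- \<mu> * xtrace_term p m))
    ({..<Suc m} \<rightarrow>\<^sub>E UNIV)"
proof -
  let ?t = "Transposition.transpose q m"
  let ?f = "\<lambda>i. - (x (i m) * minor A i p (Suc m) m)"
  have bij: "bij_betw (\<lambda>i. i \<circ> ?t) ({..<Suc m} \<rightarrow>\<^sub>E (UNIV :: nat set)) ({..<Suc m} \<rightarrow>\<^sub>E UNIV)"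
    by (rule bij_betw_byWitness[where f' = "\<lambda>i. i \<circ> ?t"])
       (use assms in \<open>auto simp: PiE_def extensional_def fun_eq_iff Transposition.transpose_def\<close>)
  have "(\<lambda>i. x (i m) * minor A i p (Suc m) m) summable_on ({..<Suc m} \<rightarrow>\<^sub>E UNIV)"
    by (rule dominated_summable(1)[OF norm_minor_le summable_ab ab_nonneg]) auto
  from has_sum_infsum[OF this] infsum_last_minor[of m p]
  have "((\<lambda>i. x (i m) * minor A i p (Suc m) m) has_sum \<mu> * xtrace_term p m) ({..<Suc m} \<rightarrow>\<^sub>E UNIV)"
    by simp
  then have "(?f has_sum (- \<mu> * xtrace_term p m)) ({..<Suc m} \<rightarrow>\<^sub>E UNIV)"
    by (simp add: has_sum_uminus)
  then have "((\<lambda>i. ?f (i \<circ> ?t)) has_sum (- \<mu> * xtrace_term p m)) ({..<Suc m} \<rightarrow>\<^sub>E UNIV)"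
    unfolding has_sum_reindex_bij_betw[OF bij, where f = ?f] .
  then show ?thesis
    unfolding minor_symmetric[OF assms] using assms by (simp add: Transposition.transpose_def)
qed

lemma pminor_summable: "(\<lambda>i. pminor i n) summable_on ({..<n} \<rightarrow>\<^sub>E UNIV)"
  by (rule dominated_summable(1)[OF norm_pminor_le summable_ab ab_nonneg])

text \<open>In the Laplace expansion along the column \<open>x\<close>, the row \<open>p\<close>
  gives the trace term; each of the other \<open>Suc m\<close> rows gives the same amount, by the
  symmetry in the indices.\<close>

lemma xtrace_term_Suc:
  "xtrace_term p (Suc m) = x p * trace_term (Suc m) - of_nat (Suc m) * \<mu> * xtrace_term p m"
proof -
  have "((\<lambda>i. x p * pminor i (Suc m)
     + (\<Sum>q<Suc m. x (i q) * ((-1) ^ (q + Suc m) * minor A i p (Suc m) q))) has_sum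
     (x p * trace_term (Suc m) + (\<Sum>q<Suc m. - \<mu> * xtrace_term p m))) ({..<Suc m} \<rightarrow>\<^sub>E UNIV)"
    unfolding trace_term_def
    by (intro has_sum_add has_sum_sum has_sum_cmult_right has_sum_infsum pminor_summable infsum_any_minor) auto
  then have "((\<lambda>i. xminor p i (Suc m)) has_sum
     (x p * trace_term (Suc m) + (\<Sum>q<Suc m. - \<mu> * xtrace_term p m))) ({..<Suc m} \<rightarrow>\<^sub>E UNIV)"
    unfolding xminor_expand .
  from infsumI[OF this] show ?thesis unfolding xtrace_term_def[of p "Suc m"]
    by (simp add: algebra_simps)
qed

text \<open>The recurrence makes the Fredholm series at \<open>1 / \<mu>\<close> telescope.\<close>

lemma fredholm_partial_sum:
  assumes "\<mu> \<noteq> 0"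
  shows "x p * (\<Sum>k<Suc n. (- (1 / \<mu>)) ^ k / fact k * trace_term k) = (- (1 / \<mu>)) ^ n / fact n * xtrace_term p n"
proof (induction n)
  case 0
  then show ?case
    by (simp add: xtrace_term_def trace_term_def xminor_0 pminor_def)
next
  case (Suc n)
  have "(- (1 / \<mu>)) ^ Suc n / fact (Suc n) * (of_nat (Suc n) * \<mu> * xtrace_term p n)
      = - ((- (1 / \<mu>)) ^ n / fact n * xtrace_term p n)"
    using assms by (simp add: field_simps del: of_nat_Suc)
  with Suc show ?case
    by (subst sum.lessThan_Suc) (simp add: xtrace_term_Suc algebra_simps del: of_nat_Suc fact_Suc sum.lessThan_Suc)
qed

text \<open>The factorial of the Leibniz bound cancels \<open>fact n\<close> up to a factor
  \<open>n + 1\<close>. Since the majorant can be made to have sum at most any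
  \<open>\<epsilon>\<close>, the rate \<open>\<epsilon> ^ n\<close> beats
  \<open>norm z ^ n\<close>.\<close>

lemma xtrace_term_tendsto:
  "(\<lambda>n. z ^ n / fact n * xtrace_term p n) \<longlonglongrightarrow> 0"
proof -
  define \<epsilon> where "\<epsilon> = 1 / (2 * (norm z + 1))"
  have \<epsilon>: "0 < \<epsilon>" unfolding \<epsilon>_def by (simp add: add_nonneg_pos)
  have z\<epsilon>: "norm z * \<epsilon> \<le> 1 / 2" unfolding \<epsilon>_def
    by (simp add: divide_simps add_nonneg_pos)
  obtain t' K where t': "summable t'" "\<And>k. 0 \<le> t' k" "suminf t' \<le> \<epsilon>" "0 \<le> K"
    "\<And>(n::nat) i. inj_on i {..<n} \<Longrightarrow> (\<Prod>c<n. a (i c) * b (i c)) \<le> K * (\<Prod>c<n. t' (i c))"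
    using inj_domination[OF summable_ab ab_nonneg \<epsilon>] by metis
  define C where "C = a p * G * K"
  have C: "0 \<le> C" using nonneg G t' unfolding C_def by simp
  have le: "norm (z ^ n / fact n * xtrace_term p n) \<le> C * (real (Suc n) * (1 / 2) ^ n)" for n
  proof -
    have "norm (xminor p i n) \<le> (fact (Suc n) * C) * (\<Prod>c<n. t' (i c))" for i
    proof (cases "inj_on i {..<n}")
      case True
      have "norm (xminor p i n) \<le> fact (Suc n) * a p * G * (\<Prod>c<n. a (i c) * b (i c))"
        by (rule norm_xminor_le)
      also have "\<dots> \<le> fact (Suc n) * a p * G * (K * (\<Prod>c<n. t' (i c)))"
        using t'(5)[OF True] nonneg G by (intro mult_left_mono) auto
      finally show ?thesis unfolding C_def by (simp add: mult_ac)
    next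
      case False
      then show ?thesis using C t' by (simp add: xminor_not_inj prod_nonneg)
    qed
    then have "norm (xtrace_term p n) \<le> fact (Suc n) * C * suminf t' ^ n"
      unfolding xtrace_term_def by (rule dominated_summable(2)) (use t' in auto)
    also have "\<dots> \<le> fact (Suc n) * C * \<epsilon> ^ n"
      using C t' by (intro mult_left_mono power_mono suminf_nonneg) auto
    finally have "norm (z ^ n / fact n * xtrace_term p n) \<le> norm z ^ n / fact n * (fact (Suc n) * C * \<epsilon> ^ n)"
      unfolding norm_mult norm_divide norm_power by (intro mult_mono) auto
    also have "\<dots> = C * (real (Suc n) * (norm z * \<epsilon>) ^ n)"
      by (simp add: field_simps power_mult_distrib)
    also have "\<dots> \<le> C * (real (Suc n) * (1 / 2) ^ n)"
      using C z\<epsilon> \<epsilon> by (intro mult_left_mono power_mono) auto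
    finally show ?thesis .
  qed
  have "(\<lambda>n. C * (real (Suc n) * (1 / 2) ^ n)) \<longlonglongrightarrow> C * 0"
    by (intro tendsto_mult_left) real_asymp
  then show ?thesis
    by (intro Lim_null_comparison[OF always_eventually[OF allI[OF le]]]) simp
qed

text \<open>After division by \<open>x p\<close> the partial sums themselves tend to 0, so
  convergence of the series comes with its value.\<close>

theorem fredholm_sum_eq_0:
  assumes "\<mu> \<noteq> 0" and "x p \<noteq> 0"
  shows "(\<Sum>n. (- (1 / \<mu>)) ^ n / fact n * trace_term n) = 0"
proof -
  have "(\<lambda>n. inverse (x p) * ((- (1 / \<mu>)) ^ n / fact n * xtrace_term p n)) \<longlonglongrightarrow> inverse (x p) * 0"
    by (intro tendsto_mult_left xtrace_term_tendsto)
  moreover have "inverse (x p) * ((- (1 / \<mu>)) ^ n / fact n * xtrace_term p n)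
      = (\<Sum>k<Suc n. (- (1 / \<mu>)) ^ k / fact k * trace_term k)" for n
    using assms unfolding fredholm_partial_sum[OF assms(1), symmetric] by (simp add: mult.assoc[symmetric])
  ultimately have "(\<lambda>n. \<Sum>k<Suc n. (- (1 / \<mu>)) ^ k / fact k * trace_term k) \<longlonglongrightarrow> 0"
    by simp
  then have "(\<lambda>n. (- (1 / \<mu>)) ^ n / fact n * trace_term n) sums 0"
    unfolding sums_def by (rule LIMSEQ_imp_Suc)
  then show ?thesis by (rule sums_unique[symmetric])
qed

end

section \<open>Nuclear operators on the disc\<close>

lemma disc_norm_bounds:
  assumes "0 < r" "\<And>z. norm z \<le> r \<Longrightarrow> norm (g z) \<le> C"
  shows "0 \<le> disc_norm r g" "disc_norm r g \<le> C" "\<And>z. norm z \<le> r \<Longrightarrow> norm (g z) \<le> disc_norm r g"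
proof -
  have bdd: "bdd_above ((\<lambda>z. norm (g z)) ` cball 0 r)"
    using assms(2) by (intro bdd_aboveI2[of _ _ C]) auto
  show le: "norm (g z) \<le> disc_norm r g" if "norm z \<le> r" for z
    unfolding disc_norm_def using that by (intro cSUP_upper[OF _ bdd]) auto
  have "0 \<le> norm (g 0)" by simp
  also have "\<dots> \<le> disc_norm r g" using le[of 0] assms by simp
  finally show "0 \<le> disc_norm r g" .
  show "disc_norm r g \<le> C"
    unfolding disc_norm_def using assms by (intro cSUP_least) auto
qed

lemma disc_norm_cong:
  "(\<And>z. norm z \<le> r \<Longrightarrow> norm (g z) = norm (h z)) \<Longrightarrow> disc_norm r g = disc_norm r h"
  unfolding disc_norm_def by (intro SUP_cong) auto

lemma disc_space_bounded:
  assumes "g \<in> disc_space r"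
  obtains C where "\<And>z. norm z \<le> r \<Longrightarrow> norm (g z) \<le> C"
proof -
  have "bounded (g ` cball 0 r)"
    using assms by (intro compact_imp_bounded compact_continuous_image) (auto simp: disc_space_def)
  then obtain C where "\<forall>z\<in>cball 0 r. norm (g z) \<le> C" by (auto simp: bounded_iff)
  then show thesis by (intro that[of C]) auto
qed

lemma
  assumes "0 < r" "g \<in> disc_space r"
  shows disc_norm_nonneg: "0 \<le> disc_norm r g"
    and norm_le_disc_norm: "norm z \<le> r \<Longrightarrow> norm (g z) \<le> disc_norm r g"
  using disc_norm_bounds[OF assms(1)] disc_space_bounded[OF assms(2)] by metis+

lemma disc_space_intros:
  "g \<in> disc_space r \<Longrightarrow> h \<in> disc_space r \<Longrightarrow> (\<lambda>z. g z + h z) \<in> disc_space r"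
  "g \<in> disc_space r \<Longrightarrow> h \<in> disc_space r \<Longrightarrow> (\<lambda>z. g z - h z) \<in> disc_space r"
  "g \<in> disc_space r \<Longrightarrow> (\<lambda>z. c * g z) \<in> disc_space r"
  "(\<And>k. k \<in> I \<Longrightarrow> u k \<in> disc_space r) \<Longrightarrow> (\<lambda>z. \<Sum>k\<in>I. u k z) \<in> disc_space r"
  by (auto simp: disc_space_def intro!: holomorphic_intros continuous_intros)

lemma holomorphic_in_disc_space: "g holomorphic_on UNIV \<Longrightarrow> g \<in> disc_space r"
  unfolding disc_space_def
  by (auto intro: holomorphic_on_subset continuous_on_subset holomorphic_on_imp_continuous_on)

lemma disc_dual_add:
  "\<lbrakk>\<phi> \<in> disc_dual r; g \<in> disc_space r; h \<in> disc_space r\<rbrakk> \<Longrightarrow> \<phi> (\<lambda>z. g z + h z) = \<phi> g + \<phi> h"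
  by (auto simp: disc_dual_def)

lemma disc_dual_cmult:
  "\<lbrakk>\<phi> \<in> disc_dual r; g \<in> disc_space r\<rbrakk> \<Longrightarrow> \<phi> (\<lambda>z. c * g z) = c * \<phi> g"
  by (auto simp: disc_dual_def)

lemma zero_in_disc_space: "(\<lambda>z. 0) \<in> disc_space r"
  by (intro holomorphic_in_disc_space holomorphic_intros)

lemma disc_dual_zero: "\<phi> \<in> disc_dual r \<Longrightarrow> \<phi> (\<lambda>z. 0) = 0"
  using disc_dual_cmult[of \<phi> r "\<lambda>z. 0" 0] zero_in_disc_space by simp

lemma disc_dual_sum:
  assumes \<phi>: "\<phi> \<in> disc_dual r" and u: "\<And>k. k \<in> I \<Longrightarrow> u k \<in> disc_space r"
  shows "\<phi> (\<lambda>z. \<Sum>k\<in>I. c k * u k z) = (\<Sum>k\<in>I. c k * \<phi> (u k))"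
  using u
proof (induction I rule: infinite_finite_induct)
  case (insert k I)
  then have "\<phi> (\<lambda>z. c k * u k z + (\<Sum>k\<in>I. c k * u k z)) = \<phi> (\<lambda>z. c k * u k z) + \<phi> (\<lambda>z. \<Sum>k\<in>I. c k * u k z)"
    by (intro disc_dual_add[OF \<phi>] disc_space_intros) auto
  then show ?case using insert disc_dual_cmult[OF \<phi>, of "u k" "c k"] by simp
qed (use disc_dual_zero[OF \<phi>] in auto)

lemma disc_dual_diff:
  assumes \<phi>: "\<phi> \<in> disc_dual r" and gh: "g \<in> disc_space r" "h \<in> disc_space r"
  shows "\<phi> (\<lambda>z. g z - h z) = \<phi> g - \<phi> h"
  using disc_dual_add[OF \<phi> gh(1) disc_space_intros(3)[OF gh(2), of "-1"]] disc_dual_cmult[OF \<phi> gh(2), of "-1"]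
  by simp

lemma
  assumes r: "0 < r" and \<phi>: "\<phi> \<in> disc_dual r"
  shows disc_dual_norm_nonneg: "0 \<le> disc_dual_norm r \<phi>"
    and norm_le_disc_dual_norm: "g \<in> disc_space r \<Longrightarrow> norm (\<phi> g) \<le> disc_dual_norm r \<phi> * disc_norm r g"
proof -
  obtain C where C: "\<And>g. g \<in> disc_space r \<Longrightarrow> norm (\<phi> g) \<le> C * disc_norm r g"
    using \<phi> unfolding disc_dual_def by blast
  have "norm (\<phi> g) \<le> \<bar>C\<bar>" if "g \<in> disc_space r" "disc_norm r g \<le> 1" for g
  proof -
    have "C * disc_norm r g \<le> \<bar>C\<bar> * 1"
      using that disc_norm_nonneg[OF r that(1)] by (intro mult_mono) auto
    then show ?thesis using C[OF that(1)] by simp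
  qed
  then have bdd: "bdd_above ((\<lambda>g. norm (\<phi> g)) ` {g \<in> disc_space r. disc_norm r g \<le> 1})"
    by (intro bdd_aboveI2[of _ _ "\<bar>C\<bar>"]) auto
  have le: "norm (\<phi> g) \<le> disc_dual_norm r \<phi>" if "g \<in> disc_space r" "disc_norm r g \<le> 1" for g
    unfolding disc_dual_norm_def using that by (intro cSUP_upper[OF _ bdd]) auto
  have "disc_norm r (\<lambda>z. 0) \<le> 1" using disc_norm_bounds(2)[OF r, of "\<lambda>z. 0" 1] by simp
  from le[OF zero_in_disc_space this] show "0 \<le> disc_dual_norm r \<phi>"
    using norm_ge_zero order_trans by blast
  show "norm (\<phi> g) \<le> disc_dual_norm r \<phi> * disc_norm r g" if g: "g \<in> disc_space r"
  proof (cases "disc_norm r g = 0")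
    case True
    then show ?thesis using C[OF g] by simp
  next
    case False
    define d where "d = disc_norm r g"
    have d: "0 < d" using False disc_norm_nonneg[OF r g] by (simp add: d_def)
    have "norm (complex_of_real (1 / d) * g z) \<le> 1" if "norm z \<le> r" for z
      using norm_le_disc_norm[OF r g that] d by (simp add: norm_mult norm_divide d_def[symmetric])
    then have "disc_norm r (\<lambda>z. complex_of_real (1 / d) * g z) \<le> 1"
      by (rule disc_norm_bounds(2)[OF r])
    then have "norm (\<phi> (\<lambda>z. complex_of_real (1 / d) * g z)) \<le> disc_dual_norm r \<phi>"
      by (intro le disc_space_intros g)
    then have "norm (complex_of_real (1 / d) * \<phi> g) \<le> disc_dual_norm r \<phi>"
      unfolding disc_dual_cmult[OF \<phi> g] .
    then show ?thesis using d
      by (simp add: norm_mult norm_divide field_simps d_def[symmetric])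
  qed
qed

lemma disc_dual_norm_le:
  assumes r: "0 < r" and "\<And>g. g \<in> disc_space r \<Longrightarrow> norm (\<phi> g) \<le> C * disc_norm r g" "0 \<le> C"
  shows "disc_dual_norm r \<phi> \<le> C"
  unfolding disc_dual_norm_def
proof (rule cSUP_least)
  show "{g \<in> disc_space r. disc_norm r g \<le> 1} \<noteq> {}"
    using zero_in_disc_space disc_norm_bounds(2)[OF r, of "\<lambda>z. 0" 1] by auto
  fix g assume g: "g \<in> {g \<in> disc_space r. disc_norm r g \<le> 1}"
  then have "norm (\<phi> g) \<le> C * disc_norm r g" using assms by auto
  also have "\<dots> \<le> C * 1" using g assms by (intro mult_left_mono) auto
  finally show "norm (\<phi> g) \<le> C" by simp
qed

text \<open>Applying phi_j to the expansion of the eigenfunction gives the matrix eigenvalue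
  equation. The representation is arbitrary, as the choice inside \<open>fredholm_det\<close>
  demands.\<close>

theorem fredholm_series_eigenvalue:
  assumes r: "0 < r" and rep: "nuclear_rep r T \<phi> f" and g: "g \<in> disc_space r"
    and eigen: "\<And>z. norm z \<le> r \<Longrightarrow> T g z = \<mu> * g z"
    and nz: "norm w \<le> r" "g w \<noteq> 0" "\<mu> \<noteq> 0"
  shows "fredholm_series \<phi> f (1 / \<mu>) = 0"
proof -
  have \<phi>: "\<phi> k \<in> disc_dual r" and f: "f k \<in> disc_space r" for k
    using rep by (auto simp: nuclear_rep_def)
  define a where "a k = disc_dual_norm r (\<phi> k)" for k
  define b where "b k = disc_norm r (f k)" for k
  define G where "G = disc_norm r g"
  have nn: "0 \<le> a k" "0 \<le> b k" for k
    using disc_dual_norm_nonneg[OF r \<phi>] disc_norm_nonneg[OF r f] by (auto simp: a_def b_def)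
  have sab: "summable (\<lambda>k. a k * b k)"
    using rep by (auto simp: nuclear_rep_def a_def b_def)
  have G: "0 \<le> G" unfolding G_def by (rule disc_norm_nonneg[OF r g])
  have xk: "norm (\<phi> k g) \<le> a k * G" for k
    unfolding a_def G_def by (rule norm_le_disc_dual_norm[OF r \<phi> g])
  have A: "norm (\<phi> j (f k)) \<le> a j * b k" for j k
    unfolding a_def b_def by (rule norm_le_disc_dual_norm[OF r \<phi> f])
  define rest where "rest N = (\<lambda>z. \<mu> * g z - (\<Sum>k<N. \<phi> k g * f k z))" for N
  have rest_in: "rest N \<in> disc_space r" for N
    unfolding rest_def by (intro disc_space_intros g f)
  have "disc_norm r (rest N) = disc_norm r (\<lambda>z. T g z - (\<Sum>k<N. \<phi> k g * f k z))" for N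
    unfolding rest_def using eigen by (intro disc_norm_cong) auto
  then have rest: "(\<lambda>N. disc_norm r (rest N)) \<longlonglongrightarrow> 0"
    using rep g by (auto simp: nuclear_rep_def)
  have has: "((\<lambda>k. \<phi> j (f k) * \<phi> k g) has_sum \<mu> * \<phi> j g) UNIV" for j
  proof (rule norm_summable_imp_has_sum)
    have le: "norm (\<phi> j (f k) * \<phi> k g) \<le> a j * G * (a k * b k)" for k
    proof -
      have "norm (\<phi> j (f k) * \<phi> k g) \<le> (a j * b k) * (a k * G)"
        unfolding norm_mult using A xk nn by (intro mult_mono) auto
      then show ?thesis by (simp add: mult_ac)
    qed
    show "summable (\<lambda>k. norm (\<phi> j (f k) * \<phi> k g))"
      by (rule summable_comparison_test'[OF summable_mult[OF sab, of "a j * G"]]) (use le in auto)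
    have eq: "\<phi> j (rest N) = \<mu> * \<phi> j g - (\<Sum>k<N. \<phi> j (f k) * \<phi> k g)" for N
      unfolding rest_def
      by (subst disc_dual_diff[OF \<phi>]) (auto intro!: disc_space_intros g f sum.cong
          simp: disc_dual_cmult[OF \<phi> g] disc_dual_sum[OF \<phi> f])
    have "(\<lambda>N. \<phi> j (rest N)) \<longlonglongrightarrow> 0"
    proof (rule Lim_null_comparison)
      show "\<forall>\<^sub>F N in sequentially. norm (\<phi> j (rest N)) \<le> a j * disc_norm r (rest N)"
        unfolding a_def using norm_le_disc_dual_norm[OF r \<phi> rest_in] by auto
      show "(\<lambda>N. a j * disc_norm r (rest N)) \<longlonglongrightarrow> 0"
        using tendsto_mult_left[OF rest, of "a j"] by simp
    qed
    then have "(\<lambda>N. \<mu> * \<phi> j g - \<phi> j (rest N)) \<longlonglongrightarrow> \<mu> * \<phi> j g - 0"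
      by (intro tendsto_intros)
    then show "(\<lambda>k. \<phi> j (f k) * \<phi> k g) sums (\<mu> * \<phi> j g)"
      unfolding sums_def by (simp add: eq)
  qed
  interpret nuclear_eigenvector "\<lambda>j k. \<phi> j (f k)" a b "\<lambda>k. \<phi> k g" G \<mu>
    by unfold_locales (fact nn sab A xk G has)+
  \<comment> \<open>If all coefficients vanished, every remainder would be \<open>\<mu> * g\<close>,
    whose norm could not tend to 0.\<close>
  have "\<exists>p. \<phi> p g \<noteq> 0"
  proof (rule ccontr)
    assume "\<nexists>p. \<phi> p g \<noteq> 0"
    then have "(\<lambda>N. disc_norm r (rest N)) = (\<lambda>N. disc_norm r (rest 0))"
      unfolding rest_def by simp
    with rest have "(\<lambda>N::nat. disc_norm r (rest 0)) \<longlonglongrightarrow> 0" by metis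
    then have "disc_norm r (rest 0) = 0" by (simp add: LIMSEQ_const_iff)
    with norm_le_disc_norm[OF r rest_in[of 0] nz(1)] nz show False
      by (simp add: rest_def)
  qed
  then obtain p where "\<phi> p g \<noteq> 0" by blast
  from fredholm_sum_eq_0[where p = p, OF nz(3) this] show ?thesis
    unfolding fredholm_series_def trace_term_def pminor_def by simp
qed

section \<open>The Ruelle operator\<close>

text \<open>The indices \<open>2 * j\<close> and \<open>2 * j + 1\<close> carry the Taylor coefficient of order \<open>j\<close> for the two branches.\<close>

definition taylor_functional :: "nat \<Rightarrow> (complex \<Rightarrow> complex) \<Rightarrow> complex"
  where "taylor_functional k g = (deriv ^^ (k div 2)) g 0 / fact (k div 2)"

definition branch_sign :: "nat \<Rightarrow> complex"
  where "branch_sign k = (if even k then 1 else -1)"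

definition branch_term :: "real \<Rightarrow> complex \<Rightarrow> nat \<Rightarrow> complex \<Rightarrow> complex"
  where "branch_term l \<beta> k z = exp (branch_sign k * \<beta> * z) * (of_real l * z + branch_sign k * of_real l) ^ (k div 2)"

lemma norm_taylor_functional_le:
  assumes r: "0 < r" and g: "g \<in> disc_space r"
  shows "norm (taylor_functional k g) \<le> (1 / r ^ (k div 2)) * disc_norm r g"
proof -
  have "norm ((deriv ^^ (k div 2)) g 0) \<le> fact (k div 2) * disc_norm r g / r ^ (k div 2)"
    using g r norm_le_disc_norm[OF r g] by (intro Cauchy_inequality) (auto simp: disc_space_def)
  then show ?thesis unfolding taylor_functional_def
    by (simp add: norm_divide field_simps)
qed

lemma taylor_functional_dual:
  assumes r: "0 < r"
  shows "taylor_functional k \<in> disc_dual r"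
proof -
  have 1: "taylor_functional k (\<lambda>z. g z + h z) = taylor_functional k g + taylor_functional k h"
    if "g \<in> disc_space r" "h \<in> disc_space r" for g h
    using that r unfolding taylor_functional_def disc_space_def
    by (subst higher_deriv_add[of _ "ball 0 r"]) (auto simp: add_divide_distrib)
  have 2: "taylor_functional k (\<lambda>z. c * g z) = c * taylor_functional k g"
    if "g \<in> disc_space r" for g c
    using that r unfolding taylor_functional_def disc_space_def
    by (subst higher_deriv_cmult[of _ "ball 0 r"]) auto
  show ?thesis unfolding disc_dual_def
    using 1 2 norm_taylor_functional_le[OF r, of _ k] by blast
qed

section \<open>Nuclearity of the Ruelle operator\<close>

lemma ruelle_parameters:
  fixes l r :: real
  assumes "0 < l" "l < 1" "l / (1 - l) < r"
  shows "0 < r" "l * (1 + r) < r"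
proof -
  have "0 < l / (1 - l)" using assms by simp
  then show "0 < r" using assms(3) by (rule less_trans)
  show "l * (1 + r) < r" using assms by (simp add: field_simps)
qed

lemma norm_affine_branch_le:
  assumes "0 \<le> l" "norm z \<le> r" "norm s = 1"
  shows "norm (complex_of_real l * z + s * of_real l) \<le> l * (1 + r)"
proof -
  have "norm (complex_of_real l * z + s * of_real l) \<le> l * norm z + l"
    using assms by (intro order_trans[OF norm_triangle_ineq]) (simp add: norm_mult)
  also have "\<dots> \<le> l * (1 + r)" using assms by (simp add: algebra_simps mult_left_mono)
  finally show ?thesis .
qed

lemma norm_exp_mult_le: "norm (exp (\<beta> * z :: complex)) \<le> exp (norm \<beta> * norm z)"
  by (metis norm_exp norm_mult)

lemma norm_branch_term_le:
  assumes "0 \<le> l" "norm z \<le> r"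
  shows "norm (branch_term l \<beta> k z) \<le> exp (norm \<beta> * r) * (l * (1 + r)) ^ (k div 2)"
proof -
  have s: "norm (branch_sign k) = 1" by (simp add: branch_sign_def)
  have "norm (exp (branch_sign k * \<beta> * z)) \<le> exp (norm (branch_sign k * \<beta>) * norm z)"
    by (rule norm_exp_mult_le)
  also have "\<dots> \<le> exp (norm \<beta> * r)"
    using assms s by (simp add: norm_mult mult_left_mono)
  finally show ?thesis
    unfolding branch_term_def norm_mult norm_power
    using norm_affine_branch_le[OF assms s] by (intro mult_mono power_mono) auto
qed

text \<open>Each power occurs twice, once per branch; a geometric series in the square root of
  \<open>q\<close> dominates both.\<close>

lemma summable_power_div_2:
  fixes q :: real
  assumes "0 < q" "q < 1"
  shows "summable (\<lambda>k. q ^ (k div 2))"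
proof (rule summable_comparison_test')
  show "summable (\<lambda>k. (1 / sqrt q) * sqrt q ^ k)"
    using assms by (intro summable_mult summable_geometric) auto
  fix k :: nat assume "0 \<le> k"
  have "q ^ (k div 2) * sqrt q = sqrt q ^ Suc (2 * (k div 2))"
    using assms by (simp add: power_mult)
  also have "\<dots> \<le> sqrt q ^ k"
    using assms by (intro power_decreasing) auto
  finally show "norm (q ^ (k div 2)) \<le> (1 / sqrt q) * sqrt q ^ k"
    using assms by (simp add: field_simps)
qed

text \<open>Both branches map the closed disc into the disc of radius
  \<open>l * (1 + r) < r\<close>. So \<open>g\<close> may be replaced there by its Taylor series,
  and Cauchy's estimates make the norms decay like powers of \<open>l * (1 + r) / r\<close>.\<close>

theorem ruelle_op_nuclear:
  fixes l r :: real
  assumes l: "0 < l" "l < 1" "l / (1 - l) < r"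
  shows "nuclear_rep r (ruelle_op l \<beta>) taylor_functional (branch_term l \<beta>)"
proof -
  note r = ruelle_parameters[OF l]
  define q where "q = l * (1 + r) / r"
  have q: "0 < q" "q < 1" using l r unfolding q_def by auto
  define E where "E = exp (norm \<beta> * r)"
  define M where "M g k = disc_norm r g * E * q ^ (k div 2)" for g k
  have sM: "summable (M g)" for g
    unfolding M_def by (intro summable_mult summable_power_div_2 q)
  have branch_in: "branch_term l \<beta> k \<in> disc_space r" for k
    unfolding branch_term_def by (intro holomorphic_in_disc_space holomorphic_intros)
  have bn: "disc_norm r (branch_term l \<beta> k) \<le> E * (l * (1 + r)) ^ (k div 2)" for k
    unfolding E_def using norm_branch_term_le[of l _ r] l r by (intro disc_norm_bounds(2)) auto
  have dn: "disc_dual_norm r (taylor_functional k) \<le> 1 / r ^ (k div 2)" for k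
    using norm_taylor_functional_le[OF r(1)] r by (intro disc_dual_norm_le) auto
  have summ: "summable (\<lambda>k. disc_dual_norm r (taylor_functional k) * disc_norm r (branch_term l \<beta> k))"
  proof (rule summable_comparison_test')
    show "summable (\<lambda>k. E * q ^ (k div 2))" by (intro summable_mult summable_power_div_2 q)
    fix k :: nat assume "0 \<le> k"
    have "disc_dual_norm r (taylor_functional k) * disc_norm r (branch_term l \<beta> k)
        \<le> (1 / r ^ (k div 2)) * (E * (l * (1 + r)) ^ (k div 2))"
      using bn dn disc_norm_nonneg[OF r(1) branch_in] r by (intro mult_mono) auto
    also have "\<dots> = E * q ^ (k div 2)" unfolding q_def by (simp add: power_divide)
    finally show "norm (disc_dual_norm r (taylor_functional k) * disc_norm r (branch_term l \<beta> k)) \<le> E * q ^ (k div 2)"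
      using disc_norm_nonneg[OF r(1) branch_in] disc_dual_norm_nonneg[OF r(1) taylor_functional_dual[OF r(1)]]
      by simp
  qed
  have conv: "(\<lambda>N. disc_norm r (\<lambda>z. ruelle_op l \<beta> g z - (\<Sum>k<N. taylor_functional k g * branch_term l \<beta> k z))) \<longlonglongrightarrow> 0"
    if g: "g \<in> disc_space r" for g
  proof -
    define u where "u z k = taylor_functional k g * branch_term l \<beta> k z" for z k
    have u: "norm (u z k) \<le> M g k" if "norm z \<le> r" for z k
    proof -
      have "norm (u z k) \<le> (1 / r ^ (k div 2) * disc_norm r g) * (E * (l * (1 + r)) ^ (k div 2))"
        unfolding u_def norm_mult E_def
        using norm_taylor_functional_le[OF r(1) g] norm_branch_term_le[of l z r] l that r disc_norm_nonneg[OF r(1) g]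
        by (intro mult_mono) auto
      also have "\<dots> = M g k" unfolding M_def q_def by (simp add: power_divide)
      finally show ?thesis .
    qed
    have su: "summable (u z)" if "norm z \<le> r" for z
      by (rule summable_comparison_test'[OF sM]) (use u[OF that] in auto)
    have sum_u: "suminf (u z) = ruelle_op l \<beta> g z" if z: "norm z \<le> r" for z
    proof -
      have tay: "(\<lambda>j. taylor_functional (2 * j) g * (of_real l * z + s * of_real l) ^ j) sums g (of_real l * z + s * of_real l)"
        if "norm s = 1" for s
      proof -
        have "norm (of_real l * z + s * of_real l) < r"
          using norm_affine_branch_le[of l z r s] l z r that by simp
        then show ?thesis
          using holomorphic_power_series[of g 0 r "of_real l * z + s * of_real l"] g
          by (simp add: taylor_functional_def disc_space_def)
      qed
      have "(\<lambda>j. exp (\<beta> * z) * (taylor_functional (2 * j) g * (of_real l * z + 1 * of_real l) ^ j)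
          + exp (- \<beta> * z) * (taylor_functional (2 * j) g * (of_real l * z + (-1) * of_real l) ^ j)) sums
          (exp (\<beta> * z) * g (of_real l * z + 1 * of_real l) + exp (- \<beta> * z) * g (of_real l * z + (-1) * of_real l))"
        by (intro sums_add sums_mult tay) auto
      also have "(\<lambda>j. exp (\<beta> * z) * (taylor_functional (2 * j) g * (of_real l * z + 1 * of_real l) ^ j)
          + exp (- \<beta> * z) * (taylor_functional (2 * j) g * (of_real l * z + (-1) * of_real l) ^ j))
          = (\<lambda>j. u z (2 * j) + u z (Suc (2 * j)))"
        by (simp add: u_def branch_term_def branch_sign_def taylor_functional_def algebra_simps)
      also have "exp (\<beta> * z) * g (of_real l * z + 1 * of_real l) + exp (- \<beta> * z) * g (of_real l * z + (-1) * of_real l)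
          = ruelle_op l \<beta> g z"
        unfolding ruelle_op_def by (simp add: add.commute)
      finally have "(\<lambda>N. \<Sum>j<N. u z (2 * j) + u z (Suc (2 * j))) \<longlonglongrightarrow> ruelle_op l \<beta> g z"
        unfolding sums_def .
      also have "(\<lambda>N. \<Sum>j<N. u z (2 * j) + u z (Suc (2 * j))) = (\<lambda>N. \<Sum>k<2 * N. u z k)"
      proof
        show "(\<Sum>j<N. u z (2 * j) + u z (Suc (2 * j))) = (\<Sum>k<2 * N. u z k)" for N
          by (induction N) auto
      qed
      finally have "(\<lambda>N. \<Sum>k<2 * N. u z k) \<longlonglongrightarrow> ruelle_op l \<beta> g z" .
      \<comment> \<open>Pairing the branches controls only the even partial sums; summability
        extends their limit to the whole series.\<close>
      moreover have "(\<lambda>N. \<Sum>k<2 * N. u z k) \<longlonglongrightarrow> suminf (u z)"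
        using LIMSEQ_subseq_LIMSEQ[OF summable_LIMSEQ[OF su[OF z]], of "\<lambda>N. 2 * N"]
        by (simp add: strict_mono_def o_def)
      ultimately show ?thesis using LIMSEQ_unique by blast
    qed
    have le: "norm (ruelle_op l \<beta> g z - (\<Sum>k<N. u z k)) \<le> suminf (M g) - (\<Sum>k<N. M g k)" if z: "norm z \<le> r" for z N
    proof -
      have "ruelle_op l \<beta> g z - (\<Sum>k<N. u z k) = (\<Sum>k. u z (k + N))"
        by (simp add: suminf_minus_initial_segment su[OF z] sum_u[OF z])
      also have "norm \<dots> \<le> (\<Sum>k. M g (k + N))"
        using u[OF z] sM by (intro norm_suminf_le) (auto simp: summable_iff_shift)
      also have "\<dots> = suminf (M g) - (\<Sum>k<N. M g k)"
        by (rule suminf_minus_initial_segment[OF sM])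
      finally show ?thesis .
    qed
    have lim: "(\<lambda>N. suminf (M g) - (\<Sum>k<N. M g k)) \<longlonglongrightarrow> suminf (M g) - suminf (M g)"
      by (intro tendsto_intros summable_LIMSEQ sM)
    show ?thesis
    proof (rule tendsto_sandwich[OF _ _ tendsto_const])
      show "(\<lambda>N. suminf (M g) - (\<Sum>k<N. M g k)) \<longlonglongrightarrow> 0" using lim by simp
    qed (use disc_norm_bounds(1,2)[OF r(1) le] in \<open>auto simp: u_def\<close>)
  qed
  show ?thesis unfolding nuclear_rep_def
    using taylor_functional_dual[OF r(1)] branch_in summ conv by blast
qed

text \<open>The Taylor representation shows that the choice in \<open>fredholm_det\<close> yields
  some nuclear representation; the general eigenvalue theorem then applies to whichever was
  chosen.\<close>

theorem fredholm_det_ruelle_eigenvalue: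
  fixes l r :: real
  assumes l: "0 < l" "l < 1" "l / (1 - l) < r" and g: "g \<in> disc_space r"
    and eigen: "\<And>z. norm z \<le> r \<Longrightarrow> ruelle_op l \<beta> g z = \<mu> * g z"
    and nz: "norm w \<le> r" "g w \<noteq> 0" "\<mu> \<noteq> 0"
  shows "fredholm_det r (ruelle_op l \<beta>) (1 / \<mu>) = 0"
proof -
  let ?P = "\<lambda>(\<phi>, f). nuclear_rep r (ruelle_op l \<beta>) \<phi> f"
  obtain \<phi> f where eq: "Eps ?P = (\<phi>, f)" by fastforce
  have "?P (taylor_functional, branch_term l \<beta>)"
    using ruelle_op_nuclear[OF l] by simp
  then have "?P (Eps ?P)" by (rule someI)
  then have "nuclear_rep r (ruelle_op l \<beta>) \<phi> f" by (simp add: eq)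
  from fredholm_series_eigenvalue[OF ruelle_parameters(1)[OF l] this g eigen nz]
  show ?thesis unfolding fredholm_det_def eq by simp
qed

section \<open>Explicit eigenfunctions for \<open>l = 1 / 2\<close>\<close>

lemma infinite_zeros_half:
  assumes r: "1 < r"
  shows "infinite {\<beta>::complex. Re \<beta> = ln 2 \<and> fredholm_det r (ruelle_op (1/2) \<beta>) (of_real (1/2)) = 0}"
proof -
  define b where "b k = Complex (ln 2) (2 * pi * real k)" for k :: nat
  have "inj b" by (auto simp: b_def inj_def)
  then have "infinite (range b)" using finite_imageD by blast
  moreover have "range b \<subseteq> {\<beta>. Re \<beta> = ln 2 \<and> fredholm_det r (ruelle_op (1/2) \<beta>) (of_real (1/2)) = 0}"
  proof clarsimp
    fix k
    have exp_b: "exp (b k) = 2"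
      unfolding b_def exp_eq_polar by (simp add: complex_eq_iff cis.simps)
    have exp_mb: "exp (- b k) = 1 / 2" using exp_b by (simp add: exp_minus)
    \<comment> \<open>At the branch points \<open>2 * b k * w\<close> becomes \<open>b k * z\<close>
      plus or minus \<open>b k\<close>. In the image the two mixed products are the constants
      \<open>- exp (- b k)\<close> and \<open>exp (- b k)\<close>, which cancel.\<close>
    define g where "g z = exp (2 * b k * z) - exp (- (2 * b k * z))" for z
    have g: "g \<in> disc_space r" unfolding g_def
      by (intro holomorphic_in_disc_space holomorphic_intros)
    have "ruelle_op (1/2) (b k) g z = 2 * g z" for z
    proof -
      have "ruelle_op (1/2) (b k) g z =
          exp (b k * z) * (exp (b k + b k * z) - exp (- b k - b k * z)) + exp (- b k * z) * (exp (- b k + b k * z) - exp (b k - b k * z))"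
        unfolding ruelle_op_def g_def by (simp add: algebra_simps)
      also have "\<dots> = exp (b k) * (exp (b k * z) * exp (b k * z) - exp (- b k * z) * exp (- b k * z))"
        by (simp add: exp_add exp_diff exp_minus field_simps)
      also have "\<dots> = 2 * g z" unfolding exp_b g_def
        by (simp add: algebra_simps flip: exp_add)
      finally show ?thesis .
    qed
    moreover have "g 1 \<noteq> 0"
    proof -
      have "exp (2 * b k) = 4" using exp_double[of "b k"] by (simp add: exp_b)
      then show ?thesis by (simp add: g_def exp_minus)
    qed
    ultimately have "fredholm_det r (ruelle_op (1/2) (b k)) (1 / 2) = 0"
      using r g by (intro fredholm_det_ruelle_eigenvalue[where w = 1 and g = g]) auto
    then show "Re (b k) = ln 2 \<and> fredholm_det r (ruelle_op (1/2) (b k)) (1 / 2) = 0"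
      by (simp add: b_def)
  qed
  ultimately show ?thesis using finite_subset by blast
qed

section \<open>Inertia of real quadratic forms\<close>

definition bform :: "nat \<Rightarrow> (nat \<Rightarrow> nat \<Rightarrow> real) \<Rightarrow> (nat \<Rightarrow> real) \<Rightarrow> (nat \<Rightarrow> real) \<Rightarrow> real"
  where "bform N Q u v = (\<Sum>i<N. \<Sum>j<N. Q i j * u i * v j)"

definition lincomb :: "nat \<Rightarrow> (nat \<Rightarrow> real) \<Rightarrow> (nat \<Rightarrow> nat \<Rightarrow> real) \<Rightarrow> nat \<Rightarrow> real"
  where "lincomb m c u n = (\<Sum>i<m. c i * u i n)"

text \<open>Says that the positive index is at least \<open>m\<close>. Independence of the witnesses
  is implied: a vanishing nontrivial combination would have value 0.\<close>

definition posdim :: "nat \<Rightarrow> (nat \<Rightarrow> nat \<Rightarrow> real) \<Rightarrow> nat \<Rightarrow> bool"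
  where "posdim N Q m \<longleftrightarrow>
    (\<exists>u. \<forall>c. (\<exists>i<m. c i \<noteq> 0) \<longrightarrow> 0 < bform N Q (lincomb m c u) (lincomb m c u))"

text \<open>Padding with zero rows makes the system square, and expansion along a zero row makes it
  singular.\<close>

lemma underdetermined_system:
  fixes A :: "nat \<Rightarrow> nat \<Rightarrow> real"
  assumes "n < m"
  obtains c where "\<exists>j<m. c j \<noteq> 0" "\<And>i. i < n \<Longrightarrow> (\<Sum>j<m. A i j * c j) = 0"
proof -
  let ?M = "mat m m (\<lambda>(i, j). if i < n then A i j else 0)"
  have "Determinant.det ?M = (\<Sum>j<m. ?M $$ (n, j) * cofactor ?M n j)"
    by (rule laplace_expansion_row) (use assms in auto)
  also have "\<dots> = 0" using assms by (intro sum.neutral) auto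
  finally obtain v where v: "v \<in> carrier_vec m" "v \<noteq> 0\<^sub>v m" "?M *\<^sub>v v = 0\<^sub>v m"
    using det_0_iff_vec_prod_zero[of ?M m] by auto
  show thesis
  proof (rule that[of "\<lambda>j. vec_index v j"])
    show "\<exists>j<m. vec_index v j \<noteq> 0"
    proof (rule ccontr)
      assume "\<not> ?thesis"
      then have "v = 0\<^sub>v m" using v(1) by (intro eq_vecI) auto
      with v(2) show False by simp
    qed
    show "(\<Sum>j<m. A i j * vec_index v j) = 0" if "i < n" for i
    proof -
      have "vec_index (?M *\<^sub>v v) i = 0" using that assms unfolding v(3) by simp
      then show ?thesis using that assms v(1)
        by (simp add: scalar_prod_def atLeast0LessThan)
    qed
  qed
qed

section \<open>Bilinearity and certificates for the index\<close>

lemma bform_cong: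
  "(\<And>n. n < N \<Longrightarrow> u n = u' n) \<Longrightarrow> (\<And>n. n < N \<Longrightarrow> v n = v' n) \<Longrightarrow> bform N Q u v = bform N Q u' v'"
  unfolding bform_def by (intro sum.cong) auto

lemma bform_commute:
  assumes "\<And>i j. i < N \<Longrightarrow> j < N \<Longrightarrow> Q i j = Q j i"
  shows "bform N Q u v = bform N Q v u"
  unfolding bform_def by (subst sum.swap) (intro sum.cong refl, use assms in auto)

lemma bform_minus: "bform N (\<lambda>i j. - Q i j) u v = - bform N Q u v"
  unfolding bform_def by (simp add: sum_negf)

lemma bform_add_left: "bform N Q (\<lambda>n. u n + u' n) v = bform N Q u v + bform N Q u' v"
  and bform_add_right: "bform N Q v (\<lambda>n. u n + u' n) = bform N Q v u + bform N Q v u'"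
  unfolding bform_def by (simp_all add: algebra_simps sum.distrib)

lemma bform_scale_left: "bform N Q (\<lambda>n. c * u n) v = c * bform N Q u v"
  and bform_scale_right: "bform N Q v (\<lambda>n. c * u n) = c * bform N Q v u"
  unfolding bform_def by (simp_all add: sum_distrib_left mult_ac)

lemma bform_sum_left: "bform N Q (\<lambda>n. \<Sum>i\<in>I. c i * u i n) v = (\<Sum>i\<in>I. c i * bform N Q (u i) v)"
proof (induction I rule: infinite_finite_induct)
  case (insert k I)
  then show ?case
    using bform_add_left[of N Q "\<lambda>n. c k * u k n" "\<lambda>n. \<Sum>i\<in>I. c i * u i n" v]
    by (simp add: bform_scale_left)
qed (simp_all add: bform_def)

lemma bform_sum_right: "bform N Q v (\<lambda>n. \<Sum>i\<in>I. c i * u i n) = (\<Sum>i\<in>I. c i * bform N Q v (u i))"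
proof (induction I rule: infinite_finite_induct)
  case (insert k I)
  then show ?case
    using bform_add_right[of N Q v "\<lambda>n. c k * u k n" "\<lambda>n. \<Sum>i\<in>I. c i * u i n"]
    by (simp add: bform_scale_right)
qed (simp_all add: bform_def)

lemma bform_lincomb:
  "bform N Q (lincomb m c u) (lincomb m c u) = (\<Sum>i<m. \<Sum>j<m. c i * c j * bform N Q (u i) (u j))"
  unfolding lincomb_def bform_sum_left bform_sum_right by (simp add: sum_distrib_left mult_ac)

text \<open>A positive and a negative subspace meet only in 0, while dimensions exceeding
  \<open>N\<close> in total would force a common nonzero vector.\<close>

lemma posdim_add_le:
  assumes pos: "posdim N Q m" and neg: "posdim N (\<lambda>i j. - Q i j) k"
  shows "m + k \<le> N"
proof (rule ccontr)
  assume "\<not> m + k \<le> N"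
  then have less: "N < m + k" by simp
  obtain u where u: "\<And>c. \<exists>i<m. c i \<noteq> 0 \<Longrightarrow> 0 < bform N Q (lincomb m c u) (lincomb m c u)"
    using pos unfolding posdim_def by blast
  obtain v where v: "\<And>c. \<exists>i<k. c i \<noteq> 0 \<Longrightarrow> bform N Q (lincomb k c v) (lincomb k c v) < 0"
    using neg unfolding posdim_def bform_minus by auto
  obtain c where c: "\<exists>j<m+k. c j \<noteq> 0"
    "\<And>n. n < N \<Longrightarrow> (\<Sum>j<m+k. (if j < m then u j n else v (j - m) n) * c j) = 0"
    using underdetermined_system[OF less, of "\<lambda>n j. if j < m then u j n else v (j - m) n"] by blast
  define d where "d j = c (m + j)" for j
  have rel: "lincomb m c u n = - 1 * lincomb k d v n" if "n < N" for n
  proof -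
    have split: "(\<Sum>j<m+k. h j) = (\<Sum>j<m. h j) + (\<Sum>j<k. h (m + j))" for h :: "nat \<Rightarrow> real"
      by (induction k) auto
    have "(\<Sum>j<m+k. (if j < m then u j n else v (j - m) n) * c j)
        = (\<Sum>j<m. u j n * c j) + (\<Sum>j<k. v j n * c (m + j))"
      unfolding split by simp
    then show ?thesis using c(2)[OF that] by (simp add: lincomb_def d_def mult_ac)
  qed
  have eq: "bform N Q (lincomb m c u) (lincomb m c u) = bform N Q (lincomb k d v) (lincomb k d v)"
  proof -
    have "bform N Q (lincomb m c u) (lincomb m c u) = bform N Q (\<lambda>n. - 1 * lincomb k d v n) (\<lambda>n. - 1 * lincomb k d v n)"
      using rel by (intro bform_cong) auto
    then show ?thesis unfolding bform_scale_left bform_scale_right by simp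
  qed
  have zero: "bform N Q (lincomb m c u) (lincomb m c u) = 0" if "\<And>i. i < m \<Longrightarrow> c i = 0" for m c u
    unfolding bform_lincomb using that by (intro sum.neutral ballI) auto
  show False
  proof (cases "\<exists>i<m. c i \<noteq> 0")
    case True
    from u[OF this] have "0 < bform N Q (lincomb k d v) (lincomb k d v)" by (simp add: eq)
    then show False using v[of d] zero[of k d v] by fastforce
  next
    case False
    then obtain j where "j < m + k" "c j \<noteq> 0" "j \<ge> m" using c(1) by force
    then have "\<exists>i<k. d i \<noteq> 0" by (intro exI[of _ "j - m"]) (auto simp: d_def)
    from v[OF this] show False using eq zero[of m c u] False by auto
  qed
qed

text \<open>The error in the quadratic form is at most \<open>\<eta>\<close> times the square of the
  sum of the \<open>\<bar>c i\<bar>\<close>, hence at most \<open>m * \<eta>\<close> times the sum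
  of squares, which \<open>\<kappa>\<close> outweighs.\<close>

lemma posdim_gram:
  fixes u :: "nat \<Rightarrow> nat \<Rightarrow> real"
  assumes gram: "\<And>i j. i < m \<Longrightarrow> j < m \<Longrightarrow> \<bar>bform N Q (u i) (u j) - \<kappa> * of_bool (i = j)\<bar> \<le> \<eta>"
    and \<eta>: "real m * \<eta> < \<kappa>"
  shows "posdim N Q m"
  unfolding posdim_def
proof (intro exI[of _ u] allI impI)
  fix c :: "nat \<Rightarrow> real"
  assume "\<exists>i<m. c i \<noteq> 0"
  then obtain i where i: "i < m" "c i \<noteq> 0" by blast
  have S: "0 < (\<Sum>i<m. (c i)\<^sup>2)"
    using i by (intro sum_pos2[of _ i]) auto
  have "\<bar>bform N Q (lincomb m c u) (lincomb m c u) - \<kappa> * (\<Sum>i<m. (c i)\<^sup>2)\<bar>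
      = \<bar>\<Sum>i<m. \<Sum>j<m. c i * c j * (bform N Q (u i) (u j) - \<kappa> * of_bool (i = j))\<bar>"
  proof -
    have "(\<Sum>j<m. c i * c j * (\<kappa> * of_bool (i = j))) = \<kappa> * (c i)\<^sup>2" if "i < m" for i
      using that by (subst sum.remove[of _ i]) (auto simp: power2_eq_square)
    then show ?thesis
      unfolding bform_lincomb right_diff_distrib sum_subtractf
      by (simp add: sum_distrib_left)
  qed
  also have "\<dots> \<le> (\<Sum>i<m. \<Sum>j<m. \<bar>c i * c j * (bform N Q (u i) (u j) - \<kappa> * of_bool (i = j))\<bar>)"
    by (intro order_trans[OF sum_abs] sum_mono sum_abs)
  also have "\<dots> \<le> (\<Sum>i<m. \<Sum>j<m. ((c i)\<^sup>2 + (c j)\<^sup>2) / 2 * \<eta>)"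
  proof (intro sum_mono)
    fix i j assume "i \<in> {..<m}" "j \<in> {..<m}"
    moreover have "\<bar>c i * c j\<bar> \<le> ((c i)\<^sup>2 + (c j)\<^sup>2) / 2"
    proof -
      have "0 \<le> (\<bar>c i\<bar> - \<bar>c j\<bar>)\<^sup>2" by simp
      then show ?thesis by (simp add: power2_diff abs_mult)
    qed
    ultimately show "\<bar>c i * c j * (bform N Q (u i) (u j) - \<kappa> * of_bool (i = j))\<bar> \<le> ((c i)\<^sup>2 + (c j)\<^sup>2) / 2 * \<eta>"
      unfolding abs_mult[of "c i * c j"] using gram by (intro mult_mono) auto
  qed
  also have "\<dots> = real m * \<eta> * (\<Sum>i<m. (c i)\<^sup>2)"
    by (simp add: sum.distrib add_divide_distrib distrib_right sum_divide_distrib[symmetric]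
        sum_distrib_right[symmetric] sum_distrib_left[symmetric])
  also have "\<dots> < \<kappa> * (\<Sum>i<m. (c i)\<^sup>2)"
    using \<eta> S by (rule mult_strict_right_mono)
  finally show "0 < bform N Q (lincomb m c u) (lincomb m c u)" by linarith
qed

lemma posdim_gram_set:
  fixes u :: "'a \<Rightarrow> nat \<Rightarrow> real"
  assumes "finite I"
    and gram: "\<And>i j. i \<in> I \<Longrightarrow> j \<in> I \<Longrightarrow> \<bar>bform N Q (u i) (u j) - \<kappa> * of_bool (i = j)\<bar> \<le> \<eta>"
    and \<eta>: "real (card I) * \<eta> < \<kappa>"
  shows "posdim N Q (card I)"
proof -
  obtain h where h: "bij_betw h {..<card I} I"
    using ex_bij_betw_nat_finite[OF assms(1)] by (auto simp: atLeast0LessThan)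
  show ?thesis
  proof (rule posdim_gram[of _ _ _ "\<lambda>i. u (h i)", OF _ \<eta>])
    fix i j assume ij: "i < card I" "j < card I"
    then have "h i = h j \<longleftrightarrow> i = j" using bij_betw_imp_inj_on[OF h] by (auto simp: inj_on_def)
    then show "\<bar>bform N Q (u (h i)) (u (h j)) - \<kappa> * of_bool (i = j)\<bar> \<le> \<eta>"
      using gram[of "h i" "h j"] bij_betwE[OF h] ij by auto
  qed
qed

section \<open>Constancy of the inertia of nondegenerate forms\<close>

definition nondegenerate :: "nat \<Rightarrow> (nat \<Rightarrow> nat \<Rightarrow> real) \<Rightarrow> bool"
  where "nondegenerate N Q \<longleftrightarrow>
    (\<forall>v. (\<forall>i<N. (\<Sum>j<N. Q i j * v j) = 0) \<longrightarrow> (\<forall>j<N. v j = 0))"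

lemma bform_unit: "i < N \<Longrightarrow> bform N Q (\<lambda>n. of_bool (n = i)) v = (\<Sum>j<N. Q i j * v j)"
  unfolding bform_def by (subst sum.remove[of _ i]) auto

text \<open>A nearly orthonormal Gram matrix certifies the index of a form, so nondegenerate forms have locally
  constant inertia without any compactness argument.\<close>

lemma orthogonal_system:
  assumes sym: "\<And>i j. i < N \<Longrightarrow> j < N \<Longrightarrow> Q i j = Q j i" and nondeg: "nondegenerate N Q"
    and "n \<le> N"
  shows "\<exists>u \<epsilon>. (\<forall>i<n. \<epsilon> i \<in> {1, -1}) \<and> (\<forall>i<n. \<forall>k<n. bform N Q (u i) (u k) = \<epsilon> i * of_bool (i = k))"
  using \<open>n \<le> N\<close>
proof (induction n)
  case (Suc n)
  then obtain u \<epsilon> where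
    "(\<forall>i<n. \<epsilon> i \<in> {1, -1}) \<and> (\<forall>i<n. \<forall>k<n. bform N Q (u i) (u k) = \<epsilon> i * of_bool (i = k))"
    by (meson Suc_leD)
  then have \<epsilon>: "\<And>i. i < n \<Longrightarrow> \<epsilon> i \<in> {1, -1}"
    and u: "\<And>i k. i < n \<Longrightarrow> k < n \<Longrightarrow> bform N Q (u i) (u k) = \<epsilon> i * of_bool (i = k)"
    by blast+
  note comm = bform_commute[of N Q, OF sym]
  have "n < N" using Suc by simp
  then obtain v0 where v0: "\<exists>j<N. v0 j \<noteq> 0" "\<And>i. i < n \<Longrightarrow> (\<Sum>j<N. (\<Sum>l<N. Q l j * u i l) * v0 j) = 0"
    using underdetermined_system[of n N "\<lambda>i j. \<Sum>l<N. Q l j * u i l"] by blast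
  have v0': "bform N Q (u i) v0 = 0" if "i < n" for i
    using v0(2)[OF that] unfolding bform_def sum_distrib_right by (subst sum.swap)
  \<comment> \<open>Otherwise the form vanishes identically on the orthogonal complement of the
    system, so \<open>v0\<close> is orthogonal to the complement as well as to the system, against
    nondegeneracy.\<close>
  have "\<exists>v. (\<forall>i<n. bform N Q (u i) v = 0) \<and> bform N Q v v \<noteq> 0"
  proof (rule ccontr)
    assume "\<not> ?thesis"
    then have iso: "bform N Q v v = 0" if "\<And>i. i < n \<Longrightarrow> bform N Q (u i) v = 0" for v
      using that by blast
    have zero: "bform N Q w v0 = 0" for w
    proof -
      \<comment> \<open>Adding \<open>p\<close> removes from \<open>w\<close> its component in the
        span of the system; since \<open>\<epsilon> i\<close> is its own inverse, it replaces a
        division.\<close>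
      define p where "p n' = (\<Sum>i<n. (- (\<epsilon> i * bform N Q (u i) w)) * u i n')" for n'
      have p: "bform N Q (u k) (\<lambda>n'. w n' + p n') = 0" if "k < n" for k
      proof -
        have "bform N Q (u k) p = (\<Sum>i<n. - (\<epsilon> i * bform N Q (u i) w) * (\<epsilon> k * of_bool (k = i)))"
          unfolding p_def bform_sum_right using that u by (intro sum.cong) auto
        also have "\<dots> = - (\<epsilon> k * bform N Q (u k) w) * \<epsilon> k"
          using that by (subst sum.remove[of _ k]) auto
        also have "\<dots> = - bform N Q (u k) w" using \<epsilon>[OF that] by auto
        finally show ?thesis by (simp add: bform_add_right)
      qed
      have pv0: "bform N Q p v0 = 0"
        unfolding p_def bform_sum_left using v0' by (intro sum.neutral) auto
      let ?w = "\<lambda>n'. w n' + p n'"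
      \<comment> \<open>Polarization: \<open>?w\<close>, \<open>v0\<close> and their sum are all
        isotropic, so the mixed term vanishes.\<close>
      have "bform N Q (\<lambda>n'. ?w n' + v0 n') (\<lambda>n'. ?w n' + v0 n') = 0"
        by (rule iso) (use p v0' in \<open>simp add: bform_add_right[of _ _ _ ?w]\<close>)
      then have "bform N Q ?w ?w + bform N Q ?w v0 + (bform N Q v0 ?w + bform N Q v0 v0) = 0"
        by (simp only: bform_add_left[of _ _ ?w v0] bform_add_right[of _ _ _ ?w v0])
      then have "bform N Q ?w v0 = 0"
        using iso[of ?w, OF p] iso[of v0, OF v0'] comm[of v0 ?w] by simp
      then show ?thesis using pv0 by (simp add: bform_add_left)
    qed
    then have "(\<Sum>j<N. Q i j * v0 j) = 0" if "i < N" for i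
      using zero[of "\<lambda>n. of_bool (n = i)"] bform_unit[OF that] by simp
    then show False using nondeg v0(1) unfolding nondegenerate_def by blast
  qed
  then obtain v where v: "\<And>i. i < n \<Longrightarrow> bform N Q (u i) v = 0" "bform N Q v v \<noteq> 0" by blast
  define s where "s = 1 / sqrt \<bar>bform N Q v v\<bar>"
  define w where "w n' = s * v n'" for n'
  have ww: "bform N Q w w = sgn (bform N Q v v)"
  proof -
    have "bform N Q w w = s * s * bform N Q v v"
      unfolding w_def bform_scale_left bform_scale_right by simp
    also have "s * s = 1 / \<bar>bform N Q v v\<bar>" unfolding s_def by simp
    finally show ?thesis using v(2) by (simp add: sgn_if)
  qed
  have uw: "bform N Q (u i) w = 0" "bform N Q w (u i) = 0" if "i < n" for i
    using v(1)[OF that] comm[of v "u i"] unfolding w_def bform_scale_left bform_scale_right by simp_all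
  have "(\<forall>i<Suc n. (\<epsilon>(n := sgn (bform N Q v v))) i \<in> {1, -1}) \<and>
      (\<forall>i<Suc n. \<forall>k<Suc n. bform N Q ((u(n := w)) i) ((u(n := w)) k) = (\<epsilon>(n := sgn (bform N Q v v))) i * of_bool (i = k))"
    using \<epsilon> u ww uw v(2) by (auto simp: less_Suc_eq sgn_if)
  then show ?case by blast
qed auto

lemma inertia_locally_constant:
  fixes Q :: "real \<Rightarrow> nat \<Rightarrow> nat \<Rightarrow> real"
  assumes cont: "\<And>i j. i < N \<Longrightarrow> j < N \<Longrightarrow> continuous_on S (\<lambda>t. Q t i j)"
    and sym: "\<And>i j. i < N \<Longrightarrow> j < N \<Longrightarrow> Q t i j = Q t j i"
    and nondeg: "nondegenerate N (Q t)" and t: "t \<in> S"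
  shows "\<exists>T k. openin (top_of_set S) T \<and> t \<in> T \<and> k \<le> N \<and>
    (\<forall>t'\<in>T. posdim N (Q t') k \<and> posdim N (\<lambda>i j. - Q t' i j) (N - k))"
proof -
  obtain u \<epsilon> where
    "(\<forall>i<N. \<epsilon> i \<in> {1, -1}) \<and> (\<forall>i<N. \<forall>k<N. bform N (Q t) (u i) (u k) = \<epsilon> i * of_bool (i = k))"
    using orthogonal_system[OF sym nondeg, of N] by blast
  then have \<epsilon>: "\<And>i. i < N \<Longrightarrow> \<epsilon> i \<in> {1, -1}"
    and u: "\<And>i k. i < N \<Longrightarrow> k < N \<Longrightarrow> bform N (Q t) (u i) (u k) = \<epsilon> i * of_bool (i = k)"
    by blast+
  define P where "P = {i. i < N \<and> \<epsilon> i = 1}"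
  define P' where "P' = {i. i < N \<and> \<epsilon> i = -1}"
  have fin: "finite P" "finite P'" by (simp_all add: P_def P'_def)
  have "P \<union> P' = {..<N}" "P \<inter> P' = {}" using \<epsilon> by (auto simp: P_def P'_def)
  then have card: "card P + card P' = N" by (metis card_Un_disjoint card_lessThan fin)
  define \<eta> where "\<eta> = 1 / (real N + 1)"
  have \<eta>: "0 < \<eta>" by (simp add: \<eta>_def)
  have \<eta>c: "real c * \<eta> < 1" if "c \<le> N" for c using that by (simp add: \<eta>_def)
  define g where "g i k t' = bform N (Q t') (u i) (u k)" for i k t'
  have g: "continuous_on S (g i k)" for i k
    unfolding g_def bform_def using cont by (intro continuous_intros) auto
  \<comment> \<open>The outer \<open>S\<close> matters for \<open>N = 0\<close>, where the
    intersection over no indices is everything.\<close>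
  define T where "T = S \<inter> (\<Inter>i<N. \<Inter>k<N. S \<inter> g i k -` ball (g i k t) \<eta>)"
  have "openin (top_of_set S) T"
  proof (cases "N = 0")
    case False
    then show ?thesis unfolding T_def
      using g by (intro openin_Int openin_INT2 continuous_openin_preimage_gen) auto
  qed (simp add: T_def)
  moreover have "t \<in> T" using t \<eta> by (auto simp: T_def)
  moreover have "posdim N (Q t') (card P) \<and> posdim N (\<lambda>i j. - Q t' i j) (N - card P)" if t': "t' \<in> T" for t'
  proof -
    have close: "\<bar>bform N (Q t') (u i) (u k) - \<epsilon> i * of_bool (i = k)\<bar> \<le> \<eta>" if "i < N" "k < N" for i k
    proof -
      have "g i k t' \<in> ball (g i k t) \<eta>" using t' that unfolding T_def by blast
      then show ?thesis unfolding g_def u[OF that] by (simp add: dist_real_def)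
    qed
    have "posdim N (Q t') (card P)"
    proof (rule posdim_gram_set[where \<kappa> = 1, OF fin(1) _ \<eta>c])
      show "\<bar>bform N (Q t') (u i) (u j) - 1 * of_bool (i = j)\<bar> \<le> \<eta>" if "i \<in> P" "j \<in> P" for i j
        using close[of i j] that by (simp add: P_def)
    qed (use card in simp)
    moreover have "posdim N (\<lambda>i j. - Q t' i j) (card P')"
    proof (rule posdim_gram_set[where \<kappa> = 1, OF fin(2) _ \<eta>c])
      show "\<bar>bform N (\<lambda>i j. - Q t' i j) (u i) (u j) - 1 * of_bool (i = j)\<bar> \<le> \<eta>" if "i \<in> P'" "j \<in> P'" for i j
        using close[of i j] that by (simp add: P'_def bform_minus abs_minus_commute)
    qed (use card in simp)
    ultimately show ?thesis using card by (metis add_diff_cancel_left')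
  qed
  moreover have "card P \<le> N" using card by simp
  ultimately show ?thesis by blast
qed

text \<open>Without degeneration the index would be constant on the connected set. It is at most
  \<open>k\<close> at \<open>a\<close>, because of the negative subspace of dimension
  \<open>N - k\<close>, and at least \<open>m > k\<close> at \<open>b\<close>.\<close>

theorem inertia_crossing:
  fixes Q :: "real \<Rightarrow> nat \<Rightarrow> nat \<Rightarrow> real"
  assumes cont: "\<And>i j. i < N \<Longrightarrow> j < N \<Longrightarrow> continuous_on S (\<lambda>t. Q t i j)"
    and sym: "\<And>t i j. t \<in> S \<Longrightarrow> i < N \<Longrightarrow> j < N \<Longrightarrow> Q t i j = Q t j i"
    and S: "connected S" "a \<in> S" "b \<in> S"
    and neg: "posdim N (\<lambda>i j. - Q a i j) (N - k)" and pos: "posdim N (Q b) m" and km: "k < m" "k \<le> N"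
  shows "\<exists>t\<in>S. \<not> nondegenerate N (Q t)"
proof (rule ccontr)
  assume "\<not> ?thesis"
  then have nondeg: "nondegenerate N (Q t)" if "t \<in> S" for t using that by blast
  \<comment> \<open>Taking the set of all exact indices avoids choosing one; by
    \<open>posdim_add_le\<close> the set is a singleton as soon as it is inhabited.\<close>
  define f where "f t = {k. k \<le> N \<and> posdim N (Q t) k \<and> posdim N (\<lambda>i j. - Q t i j) (N - k)}" for t
  have f_eq: "f t = {k}" if "k \<le> N" "posdim N (Q t) k" "posdim N (\<lambda>i j. - Q t i j) (N - k)" for t k
  proof -
    have "k' = k" if "k' \<in> f t" for k'
      using posdim_add_le[of N "Q t" k' "N - k"] posdim_add_le[of N "Q t" k "N - k'"] that
        \<open>k \<le> N\<close> \<open>posdim N (Q t) k\<close> \<open>posdim N (\<lambda>i j. - Q t i j) (N - k)\<close> unfolding f_def by simp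
    then show ?thesis using that unfolding f_def by blast
  qed
  have loc: "\<exists>T k. openin (top_of_set S) T \<and> t \<in> T \<and> (\<forall>t'\<in>T. f t' = {k})" if tS: "t \<in> S" for t
  proof -
    obtain T k where "openin (top_of_set S) T" "t \<in> T" and k: "k \<le> N"
      and T: "\<And>t'. t' \<in> T \<Longrightarrow> posdim N (Q t') k \<and> posdim N (\<lambda>i j. - Q t' i j) (N - k)"
      using inertia_locally_constant[OF cont sym[OF tS] nondeg[OF tS] tS] by blast
    moreover have "f t' = {k}" if "t' \<in> T" for t'
      using f_eq[OF k] T[OF that] by blast
    ultimately show ?thesis by blast
  qed
  have "f constant_on S"
  proof (rule locally_constant_imp_constant[OF S(1)])
    fix t assume "t \<in> S"
    from loc[OF this] show "\<exists>T. openin (top_of_set S) T \<and> t \<in> T \<and> (\<forall>x\<in>T. f x = f t)" by fastforce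
  qed
  then have "f a = f b" using S unfolding constant_on_def by metis
  moreover obtain j where "f a = {j}" using loc[OF S(2)] by blast
  ultimately have "j \<in> f a" "j \<in> f b" by auto
  then show False
    using posdim_add_le[OF _ neg, of j] posdim_add_le[OF pos, of "N - j"] km by (auto simp: f_def)
qed

section \<open>The quadratic form of the Ruelle operator\<close>

text \<open>The coefficient of \<open>z ^ k\<close> in \<open>(z + s) ^ n\<close>; for
  \<open>k > n\<close> the binomial coefficient hides the truncated subtraction.\<close>

definition shift_coeff :: "real \<Rightarrow> nat \<Rightarrow> nat \<Rightarrow> real"
  where "shift_coeff s k n = real (n choose k) * s ^ (n - k)"

text \<open>In the Fock space in which \<open>z ^ n\<close> has squared norm \<open>fact n / t ^ n\<close>, multiplication by
  \<open>exp (s * t * z)\<close> is adjoint to the translation \<open>T\<^sub>s y z = y (z + s)\<close>. Hence the Ruelle operator with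
  parameter \<open>t\<close> is \<open>P S\<close>, where \<open>S g z = g (l * z)\<close> and \<open>P\<close> is the sum of \<open>T\<^sub>s\<^sup>* T\<^sub>s\<close> over \<open>s = 1, -1\<close>; both are
  positive. The form below is \<open>l \<langle>y, P y\<rangle> - \<langle>y, S\<^sup>-\<^sup>1 y\<rangle>\<close> on polynomials \<open>y = S f\<close> of degree less than \<open>N\<close>: its
  kernel consists of the solutions of the truncated equation for the eigenvalue \<open>1 / l\<close>.\<close>

definition kac_form :: "real \<Rightarrow> nat \<Rightarrow> real \<Rightarrow> nat \<Rightarrow> nat \<Rightarrow> real"
  where "kac_form l N t m n =
    l * (\<Sum>s\<in>{1, -1}. \<Sum>k<N. fact k / t ^ k * shift_coeff s k m * shift_coeff s k n)
    - (if m = n then fact n / (l * t) ^ n else 0)"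

lemma kac_form_sym: "kac_form l N t m n = kac_form l N t n m"
  unfolding kac_form_def by (simp add: mult_ac)

lemma continuous_on_kac_form:
  assumes "0 < l"
  shows "continuous_on {0<..} (\<lambda>t. kac_form l N t m n)"
  unfolding kac_form_def using assms
  by (cases "m = n") (auto intro!: continuous_intros)

lemma bform_kac_form:
  "bform N (kac_form l N t) u v =
    l * (\<Sum>s\<in>{1, -1}. \<Sum>k<N. fact k / t ^ k * (\<Sum>n<N. shift_coeff s k n * u n) * (\<Sum>n<N. shift_coeff s k n * v n))
    - (\<Sum>n<N. fact n / (l * t) ^ n * u n * v n)"
proof -
  have swap: "(\<Sum>n<N. \<Sum>s\<in>{1, -1}. \<Sum>k<N. F n s k) = (\<Sum>s\<in>{1, -1}. \<Sum>k<N. \<Sum>n<N. F n s k)"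
    for F :: "nat \<Rightarrow> real \<Rightarrow> nat \<Rightarrow> real"
    by (subst sum.swap) (rule sum.cong[OF refl], rule sum.swap)
  define X where "X m n = l * (\<Sum>s\<in>{1, -1}. \<Sum>k<N. fact k / t ^ k * shift_coeff s k m * shift_coeff s k n)" for m n
  define Y where "Y m n = (if m = n then fact n / (l * t) ^ n else 0)" for m n
  have "bform N (kac_form l N t) u v = (\<Sum>m<N. \<Sum>n<N. X m n * u m * v n) - (\<Sum>m<N. \<Sum>n<N. Y m n * u m * v n)"
    unfolding bform_def kac_form_def X_def Y_def by (simp only: left_diff_distrib sum_subtractf)
  also have "(\<Sum>m<N. \<Sum>n<N. Y m n * u m * v n) = (\<Sum>m<N. fact m / (l * t) ^ m * u m * v m)"
  proof (rule sum.cong[OF refl])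
    fix m assume "m \<in> {..<N}"
    then show "(\<Sum>n<N. Y m n * u m * v n) = fact m / (l * t) ^ m * u m * v m"
      unfolding Y_def by (subst sum.remove[of _ m]) auto
  qed
  also have "(\<Sum>m<N. \<Sum>n<N. X m n * u m * v n) =
      (\<Sum>m<N. \<Sum>n<N. \<Sum>s\<in>{1, -1}. \<Sum>k<N. l * (fact k / t ^ k * (shift_coeff s k m * u m) * (shift_coeff s k n * v n)))"
    unfolding X_def sum_distrib_left sum_distrib_right by (simp only: mult_ac)
  also have "\<dots> = (\<Sum>m<N. \<Sum>s\<in>{1, -1}. \<Sum>k<N. \<Sum>n<N. l * (fact k / t ^ k * (shift_coeff s k m * u m) * (shift_coeff s k n * v n)))"
    by (rule sum.cong[OF refl]) (rule swap)
  also have "\<dots> = (\<Sum>s\<in>{1, -1}. \<Sum>k<N. \<Sum>m<N. \<Sum>n<N. l * (fact k / t ^ k * (shift_coeff s k m * u m) * (shift_coeff s k n * v n)))"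
    by (rule swap)
  also have "\<dots> = l * (\<Sum>s\<in>{1, -1}. \<Sum>k<N. fact k / t ^ k * (\<Sum>n<N. shift_coeff s k n * u n) * (\<Sum>n<N. shift_coeff s k n * v n))"
    unfolding sum_distrib_left[of l]
    by (intro sum.cong refl) (simp only: mult.assoc sum_product, simp only: sum_distrib_left)
  finally show ?thesis .
qed

text \<open>Translation does not raise the degree, so enlarging the truncation leaves the old
  entries unchanged and positive vectors can be extended by zeros.\<close>

lemma kac_form_mono:
  assumes "posdim N (kac_form l N t) m" "N \<le> N'"
  shows "posdim N' (kac_form l N' t) m"
proof -
  obtain u where u: "\<And>c. \<exists>i<m. c i \<noteq> 0 \<Longrightarrow> 0 < bform N (kac_form l N t) (lincomb m c u) (lincomb m c u)"
    using assms unfolding posdim_def by blast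
  define u' where "u' i n = (if n < N then u i n else 0)" for i n
  have restrict: "(\<Sum>n<N'. g n) = (\<Sum>n<N. g n)" if "\<And>n. N \<le> n \<Longrightarrow> g n = 0" for g :: "nat \<Rightarrow> real"
    using assms(2) that by (intro sum.mono_neutral_right) auto
  have "bform N' (kac_form l N' t) (lincomb m c u') (lincomb m c u') = bform N (kac_form l N t) (lincomb m c u) (lincomb m c u)" for c
  proof -
    have out: "lincomb m c u' n = 0" if "N \<le> n" for n using that by (simp add: lincomb_def u'_def)
    have ins: "lincomb m c u' n = lincomb m c u n" if "n < N" for n using that by (simp add: lincomb_def u'_def)
    have form: "kac_form l N' t i j = kac_form l N t i j" if "i < N" "j < N" for i j
      unfolding kac_form_def using that
      by (intro arg_cong2[where f = "(-)"] arg_cong2[where f = "(*)"] sum.cong refl restrict)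
         (simp add: shift_coeff_def)
    have "bform N' (kac_form l N' t) (lincomb m c u') (lincomb m c u')
        = (\<Sum>i<N. \<Sum>j<N. kac_form l N' t i j * lincomb m c u' i * lincomb m c u' j)"
      unfolding bform_def by (simp add: restrict out)
    also have "\<dots> = bform N (kac_form l N t) (lincomb m c u) (lincomb m c u)"
      unfolding bform_def by (intro sum.cong refl) (simp add: ins form)
    finally show ?thesis .
  qed
  with u have "0 < bform N' (kac_form l N' t) (lincomb m c u') (lincomb m c u')" if "\<exists>i<m. c i \<noteq> 0" for c
    using that by simp
  then show ?thesis unfolding posdim_def by blast
qed

text \<open>The factor \<open>fact k * (n choose k) / fact n\<close> is \<open>1 / fact (n - k)\<close>; splitting \<open>t ^ j / fact j\<close> as
  \<open>\<epsilon> ^ j * ((t / \<epsilon>) ^ j / fact j)\<close> leaves a binomial sum.\<close>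

lemma shift_norm_le:
  fixes l t \<epsilon> :: real
  assumes "0 < l" "0 < t" "0 < \<epsilon>"
  shows "(\<Sum>k<N. fact k / t ^ k * (real (n choose k))\<^sup>2 * ((l * t) ^ n / fact n)) \<le> exp (t / \<epsilon>) * (l * (1 + \<epsilon>)) ^ n"
proof -
  have "(\<Sum>k<N. fact k / t ^ k * (real (n choose k))\<^sup>2 * ((l * t) ^ n / fact n))
      \<le> (\<Sum>k<max N (Suc n). fact k / t ^ k * (real (n choose k))\<^sup>2 * ((l * t) ^ n / fact n))"
    using assms by (intro sum_mono2) auto
  also have "\<dots> = (\<Sum>k\<le>n. fact k / t ^ k * (real (n choose k))\<^sup>2 * ((l * t) ^ n / fact n))"
    by (intro sum.mono_neutral_right) auto
  also have "\<dots> \<le> (\<Sum>k\<le>n. l ^ n * exp (t / \<epsilon>) * (of_nat (n choose k) * 1 ^ k * \<epsilon> ^ (n - k)))"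
  proof (intro sum_mono)
    fix k assume "k \<in> {..n}"
    then have k: "k \<le> n" by simp
    have "fact k / t ^ k * (real (n choose k))\<^sup>2 * ((l * t) ^ n / fact n)
        = l ^ n * real (n choose k) * (t ^ (n - k) / fact (n - k))"
      using k assms by (simp add: binomial_fact field_simps power2_eq_square power_diff power_mult_distrib)
    also have "t ^ (n - k) / fact (n - k) = \<epsilon> ^ (n - k) * ((t / \<epsilon>) ^ (n - k) / fact (n - k))"
      using assms by (simp add: power_divide)
    also have "l ^ n * real (n choose k) * (\<epsilon> ^ (n - k) * ((t / \<epsilon>) ^ (n - k) / fact (n - k)))
        \<le> l ^ n * real (n choose k) * (\<epsilon> ^ (n - k) * exp (t / \<epsilon>))"
    proof -
      have "(\<Sum>i\<in>{n - k}. (t / \<epsilon>) ^ i /\<^sub>R fact i) \<le> exp (t / \<epsilon>)"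
        unfolding exp_def using assms by (intro sum_le_suminf summable_exp_generic) auto
      then have "(t / \<epsilon>) ^ (n - k) / fact (n - k) \<le> exp (t / \<epsilon>)"
        by (simp add: divide_inverse mult.commute)
      then show ?thesis using assms by (intro mult_left_mono) auto
    qed
    finally show "fact k / t ^ k * (real (n choose k))\<^sup>2 * ((l * t) ^ n / fact n)
        \<le> l ^ n * exp (t / \<epsilon>) * (of_nat (n choose k) * 1 ^ k * \<epsilon> ^ (n - k))"
      by (simp add: mult_ac)
  qed
  also have "\<dots> = exp (t / \<epsilon>) * (l * (1 + \<epsilon>)) ^ n"
    unfolding sum_distrib_left[symmetric] binomial_ring[symmetric] by (simp add: power_mult_distrib)
  finally show ?thesis .
qed

text \<open>A Hilbert-Schmidt estimate. By Cauchy-Schwarz with the weights of the subtracted form,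
  the translation part on degrees at least \<open>k\<close> is at most a geometric tail times that
  form. The tail is below 1 for a \<open>k\<close> that depends on \<open>l\<close> and
  \<open>t\<close> but not on \<open>N\<close>.\<close>

lemma kac_form_negative:
  fixes l t :: real
  assumes l: "0 < l" "l < 1" and t: "0 < t"
  obtains k where "\<And>N. k \<le> N \<Longrightarrow> posdim N (\<lambda>i j. - kac_form l N t i j) (N - k)"
proof -
  \<comment> \<open>Chosen so that the ratio \<open>l * (1 + \<epsilon>)\<close> is the midpoint of
    \<open>l\<close> and 1.\<close>
  define \<epsilon> where "\<epsilon> = (1 / l - 1) / 2"
  define \<rho> where "\<rho> = l * (1 + \<epsilon>)"
  define E where "E = exp (t / \<epsilon>)"
  have \<epsilon>: "0 < \<epsilon>" using l by (simp add: \<epsilon>_def)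
  have "\<rho> = (1 + l) / 2" using l by (simp add: \<rho>_def \<epsilon>_def field_simps)
  then have \<rho>: "0 < \<rho>" "\<rho> < 1" using l by auto
  have "(\<lambda>k. 2 * l * E * \<rho> ^ k / (1 - \<rho>)) \<longlonglongrightarrow> 2 * l * E * 0 / (1 - \<rho>)"
    using \<rho> by (intro tendsto_intros LIMSEQ_realpow_zero) auto
  then have "\<forall>\<^sub>F k in sequentially. 2 * l * E * \<rho> ^ k / (1 - \<rho>) < 1"
    by (rule order_tendstoD) simp
  then obtain j where j: "2 * l * E * \<rho> ^ j / (1 - \<rho>) < 1"
    unfolding eventually_sequentially by blast
  show thesis
  proof (rule that)
    fix N assume N: "j \<le> N"
    show "posdim N (\<lambda>i j. - kac_form l N t i j) (N - j)"
      unfolding posdim_def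
    proof (intro exI[of _ "\<lambda>i n. of_bool (n = i + j)"] allI impI)
      fix c :: "nat \<Rightarrow> real" assume "\<exists>i<N - j. c i \<noteq> 0"
      then obtain i where i: "i < N - j" "c i \<noteq> 0" by blast
      define y where "y = lincomb (N - j) c (\<lambda>i n. of_bool (n = i + j))"
      have y0: "y n = 0" if "n < j" for n
        unfolding y_def lincomb_def using that by (intro sum.neutral) auto
      have yi: "y (i + j) \<noteq> 0"
        unfolding y_def lincomb_def using i by (subst sum.remove[of _ i]) auto
      define w where "w n = fact n / (l * t) ^ n" for n
      have w: "0 < w n" for n using l t by (simp add: w_def)
      define Y where "Y = (\<Sum>n<N. w n * (y n)\<^sup>2)"
      have Y: "0 < Y" unfolding Y_def
        using i yi w by (intro sum_pos2[of _ "i + j"]) (auto simp: less_imp_le)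
      have CS: "(\<Sum>n<N. shift_coeff s k n * y n)\<^sup>2 \<le> (\<Sum>n=j..<N. (real (n choose k))\<^sup>2 * ((l * t) ^ n / fact n)) * Y"
        if s: "s \<in> {1, -1}" for s k
      proof -
        have s2: "(s ^ i)\<^sup>2 = 1" for i using s by (auto simp: power_mult[symmetric])
        have "(\<Sum>n<N. shift_coeff s k n * y n) = (\<Sum>n=j..<N. (shift_coeff s k n / sqrt (w n)) * (sqrt (w n) * y n))"
          using w N y0 by (intro sum.mono_neutral_cong_right) (auto simp: less_imp_neq[THEN not_sym])
        then have "(\<Sum>n<N. shift_coeff s k n * y n)\<^sup>2
            \<le> (\<Sum>n=j..<N. (shift_coeff s k n / sqrt (w n))\<^sup>2) * (\<Sum>n=j..<N. (sqrt (w n) * y n)\<^sup>2)"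
          by (simp only: Cauchy_Schwarz_ineq_sum)
        also have "(\<Sum>n=j..<N. (shift_coeff s k n / sqrt (w n))\<^sup>2) = (\<Sum>n=j..<N. (real (n choose k))\<^sup>2 * ((l * t) ^ n / fact n))"
          using w by (intro sum.cong refl)
            (simp add: power_divide power_mult_distrib shift_coeff_def s2 less_imp_le, simp add: w_def power_mult_distrib)
        also have "(\<Sum>n=j..<N. (sqrt (w n) * y n)\<^sup>2) \<le> Y"
          unfolding Y_def power_mult_distrib using w by (auto simp: less_imp_le intro!: sum_mono2)
        finally show ?thesis
          using l t by (simp add: mult_left_mono sum_nonneg)
      qed
      have tail: "(\<Sum>n=j..<N. E * \<rho> ^ n) \<le> E * \<rho> ^ j / (1 - \<rho>)"
      proof -
        have "(1 - \<rho>) * (\<Sum>n=j..<N. E * \<rho> ^ n) = E * (\<rho> ^ j - \<rho> ^ N)"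
          using N by (induction N rule: dec_induct) (simp_all add: distrib_left, simp add: algebra_simps)
        then have "(\<Sum>n=j..<N. E * \<rho> ^ n) = E * ((\<rho> ^ j - \<rho> ^ N) / (1 - \<rho>))"
          using \<rho> by (simp add: field_simps)
        also have "\<dots> \<le> E * (\<rho> ^ j / (1 - \<rho>))"
          using \<rho> by (intro mult_left_mono divide_right_mono) (auto simp: E_def)
        finally show ?thesis by simp
      qed
      have "l * (\<Sum>s\<in>{1, -1}. \<Sum>k<N. fact k / t ^ k * (\<Sum>n<N. shift_coeff s k n * y n) * (\<Sum>n<N. shift_coeff s k n * y n))
          \<le> l * (\<Sum>s\<in>{1::real, -1}. \<Sum>k<N. fact k / t ^ k * ((\<Sum>n=j..<N. (real (n choose k))\<^sup>2 * ((l * t) ^ n / fact n)) * Y))"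
        using CS l t unfolding mult.assoc power2_eq_square[of "sum _ _", symmetric]
        by (intro mult_left_mono sum_mono) auto
      also have "\<dots> = 2 * l * (\<Sum>n=j..<N. \<Sum>k<N. fact k / t ^ k * (real (n choose k))\<^sup>2 * ((l * t) ^ n / fact n)) * Y"
        by (subst (2) sum.swap) (simp add: sum_distrib_left sum_distrib_right mult_ac)
      also have "\<dots> \<le> 2 * l * (\<Sum>n=j..<N. E * \<rho> ^ n) * Y"
        using l Y shift_norm_le[OF l(1) t \<epsilon>] unfolding E_def \<rho>_def
        by (intro mult_right_mono mult_left_mono sum_mono) auto
      also have "\<dots> \<le> 2 * l * (E * \<rho> ^ j / (1 - \<rho>)) * Y"
        using l Y tail by (intro mult_right_mono mult_left_mono) auto
      also have "\<dots> < 1 * Y"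
        using j by (intro mult_strict_right_mono Y) simp
      also have "\<dots> = (\<Sum>n<N. fact n / (l * t) ^ n * y n * y n)"
        unfolding Y_def w_def by (simp add: power2_eq_square mult_ac)
      finally show "0 < bform N (\<lambda>i j. - kac_form l N t i j) (lincomb (N - j) c (\<lambda>i n. of_bool (n = i + j))) (lincomb (N - j) c (\<lambda>i n. of_bool (n = i + j)))"
        unfolding bform_minus bform_kac_form y_def[symmetric] by simp
    qed
  qed
qed

section \<open>Positive index from coherent states\<close>

lemma shift_coeff_power_series:
  fixes x s :: real
  shows "(\<Sum>n<N. shift_coeff s k n * (x ^ n / fact n)) = x ^ k / fact k * (\<Sum>i<N - k. (s * x) ^ i / fact i)"
proof -
  have "(\<Sum>n<N. shift_coeff s k n * (x ^ n / fact n)) = (\<Sum>n\<in>{n. k \<le> n \<and> n < N}. shift_coeff s k n * (x ^ n / fact n))"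
    by (intro sum.mono_neutral_right) (auto simp: shift_coeff_def)
  also have "\<dots> = (\<Sum>i<N - k. shift_coeff s k (i + k) * (x ^ (i + k) / fact (i + k)))"
    by (rule sum.reindex_bij_witness[of _ "\<lambda>i. i + k" "\<lambda>n. n - k"]) auto
  also have "\<dots> = (\<Sum>i<N - k. x ^ k / fact k * ((s * x) ^ i / fact i))"
    by (intro sum.cong refl) (simp add: shift_coeff_def binomial_fact power_add power_mult_distrib field_simps)
  finally show ?thesis by (simp add: sum_distrib_left)
qed

lemma partial_exp_tendsto: "(\<lambda>N. \<Sum>i<N. (x::real) ^ i / fact i) \<longlonglongrightarrow> exp x"
  using exp_converges[of x] by (simp add: sums_def divide_inverse mult.commute)

lemma partial_exp_le:
  assumes "0 \<le> (x::real)"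
  shows "(\<Sum>i<N. x ^ i / fact i) \<le> exp x"
  using sum_le_suminf[OF sums_summable[OF exp_converges[of x]], of "{..<N}"] assms
    sums_unique[OF exp_converges[of x]] by (simp add: divide_inverse mult.commute)

text \<open>The limit is the Fock inner product of the translates by \<open>s\<close> of
  \<open>exp (x * z)\<close> and \<open>exp (y * z)\<close>. Since the summands and the range both
  depend on \<open>N\<close>, dominated convergence for series is used; nonnegative \<open>x\<close>
  and \<open>y\<close> provide the majorant.\<close>

lemma coherent_limit:
  fixes x y s t :: real
  assumes s: "s \<in> {1, -1}" and xy: "0 \<le> x" "0 \<le> y" and t: "0 < t"
  shows "(\<lambda>N. \<Sum>k<N. fact k / t ^ k * (\<Sum>n<N. shift_coeff s k n * (x ^ n / fact n)) * (\<Sum>n<N. shift_coeff s k n * (y ^ n / fact n)))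
    \<longlonglongrightarrow> exp (s * (x + y) + x * y / t)"
proof -
  define A where "A x k N = (\<Sum>n<N. shift_coeff s k n * (x ^ n / fact n))" for x k N
  have A_lim: "A x k \<longlonglongrightarrow> x ^ k / fact k * exp (s * x)" for x k
  proof -
    have "(\<lambda>N. x ^ k / fact k * (\<Sum>i<N - k. (s * x) ^ i / fact i)) \<longlonglongrightarrow> x ^ k / fact k * exp (s * x)"
      by (intro tendsto_intros filterlim_compose[OF partial_exp_tendsto] filterlim_minus_const_nat_at_top)
    then show ?thesis unfolding A_def shift_coeff_power_series .
  qed
  have A_le: "\<bar>A x k N\<bar> \<le> x ^ k / fact k * exp x" if "0 \<le> x" for x k N
  proof -
    have "\<bar>\<Sum>i<N - k. (s * x) ^ i / fact i\<bar> \<le> (\<Sum>i<N - k. x ^ i / fact i)"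
      using s that by (intro order_trans[OF sum_abs] sum_mono) (auto simp: abs_mult power_mult_distrib power_abs)
    also have "\<dots> \<le> exp x" by (rule partial_exp_le[OF that])
    finally show ?thesis unfolding A_def shift_coeff_power_series abs_mult
      using that by (intro mult_mono) auto
  qed
  define a where "a k N = (if k < N then fact k / t ^ k * A x k N * A y k N else 0)" for k N
  define b where "b k = exp (s * (x + y)) * ((x * y / t) ^ k / fact k)" for k
  define M where "M k = exp (x + y) * ((x * y / t) ^ k / fact k)" for k
  have exp_sums: "(\<lambda>k. (x * y / t) ^ k / fact k) sums exp (x * y / t)"
    using exp_converges[of "x * y / t"] by (simp add: divide_inverse mult.commute)
  have "(\<lambda>N. \<Sum>k. a k N) \<longlonglongrightarrow> suminf b"
  proof (rule tannerys_theorem[where M = M, THEN conjunct2, THEN conjunct2])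
    show "a k \<longlonglongrightarrow> b k" for k
    proof -
      have "(\<lambda>N. fact k / t ^ k * A x k N * A y k N) \<longlonglongrightarrow> fact k / t ^ k * (x ^ k / fact k * exp (s * x)) * (y ^ k / fact k * exp (s * y))"
        by (intro tendsto_intros A_lim)
      also have "fact k / t ^ k * (x ^ k / fact k * exp (s * x)) * (y ^ k / fact k * exp (s * y)) = b k"
        unfolding b_def using t by (simp add: exp_add distrib_left power_divide power_mult_distrib)
      finally show ?thesis
        by (rule Lim_transform_eventually) (auto simp: a_def intro: eventually_mono[OF eventually_gt_at_top[of k]])
    qed
    have le: "norm (a k N) \<le> M k" for k N
    proof (cases "k < N")
      case True
      have "\<bar>A x k N\<bar> * \<bar>A y k N\<bar> \<le> (x ^ k / fact k * exp x) * (y ^ k / fact k * exp y)"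
        using xy by (intro mult_mono A_le) auto
      then have "fact k / t ^ k * (\<bar>A x k N\<bar> * \<bar>A y k N\<bar>) \<le> fact k / t ^ k * ((x ^ k / fact k * exp x) * (y ^ k / fact k * exp y))"
        using t by (intro mult_left_mono) auto
      also have "\<dots> = M k" unfolding M_def using t by (simp add: exp_add power_divide power_mult_distrib)
      finally show ?thesis using True t by (simp add: a_def abs_mult mult.assoc)
    next
      case False
      then show ?thesis using xy t by (simp add: a_def M_def)
    qed
    show "eventually (\<lambda>(k, N). norm (a k N) \<le> M k) (at_top \<times>\<^sub>F sequentially)"
      using le by (intro always_eventually) auto
    show "summable M" unfolding M_def by (intro summable_mult sums_summable[OF exp_sums])
  qed simp
  moreover have "(\<Sum>k. a k N) = (\<Sum>k<N. fact k / t ^ k * A x k N * A y k N)" for N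
    by (subst suminf_finite[of "{..<N}"]) (auto simp: a_def)
  moreover have "suminf b = exp (s * (x + y) + x * y / t)"
    unfolding b_def exp_add using sums_unique[OF sums_mult[OF exp_sums, of "exp (s * (x + y))"]] by simp
  ultimately show ?thesis by (simp add: A_def)
qed

text \<open>Normalized coherent states \<open>exp (t * x * z)\<close> with distinct \<open>x\<close> in \<open>(0, l]\<close>; their Gram matrix for the
  form tends to \<open>l\<close> times the identity as \<open>t\<close> grows, so the positive index is unbounded.\<close>

definition center :: "real \<Rightarrow> nat \<Rightarrow> real"
  where "center l i = l / real (Suc i)"

text \<open>The prefactor gives the translate by \<open>s = 1\<close> Fock norm 1, so this branch
  contributes exactly \<open>l\<close> to the diagonal of the form.\<close>

definition coherent :: "real \<Rightarrow> real \<Rightarrow> nat \<Rightarrow> nat \<Rightarrow> real"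
  where "coherent l t i n = exp (- (t * ((center l i)\<^sup>2 / 2 + center l i))) * ((t * center l i) ^ n / fact n)"

text \<open>The three terms come from the branches \<open>s = 1\<close> and \<open>s = -1\<close>
  and from the subtracted form, in this order.\<close>

definition coherent_gram :: "real \<Rightarrow> real \<Rightarrow> nat \<Rightarrow> nat \<Rightarrow> real"
  where "coherent_gram l t i j =
    (let x = center l i; y = center l j in
      l * exp (- (t * ((x - y)\<^sup>2 / 2))) + l * exp (- (t * ((x - y)\<^sup>2 / 2 + 2 * (x + y))))
      - exp (- (t * ((x\<^sup>2 + y\<^sup>2) / 2 + x + y - x * y / l))))"

lemma center_bounds:
  assumes "0 < l"
  shows "0 < center l i" "center l i \<le> l"
  using assms by (auto simp: center_def field_simps)

lemma bform_coherent_tendsto: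
  assumes l: "0 < l" and t: "0 < t"
  shows "(\<lambda>N. bform N (kac_form l N t) (coherent l t i) (coherent l t j)) \<longlonglongrightarrow> coherent_gram l t i j"
proof -
  define x where "x = center l i"
  define y where "y = center l j"
  define p where "p = exp (- (t * (x\<^sup>2 / 2 + x)))"
  define q where "q = exp (- (t * (y\<^sup>2 / 2 + y)))"
  have xy: "0 < x" "0 < y" using center_bounds[OF l] by (auto simp: x_def y_def)
  have uv: "coherent l t i n = p * ((t * x) ^ n / fact n)" "coherent l t j n = q * ((t * y) ^ n / fact n)" for n
    by (simp_all add: coherent_def p_def q_def x_def y_def)
  have eq: "bform N (kac_form l N t) (coherent l t i) (coherent l t j) =
    p * q * (l * (\<Sum>s\<in>{1, -1}. \<Sum>k<N. fact k / t ^ k * (\<Sum>n<N. shift_coeff s k n * ((t * x) ^ n / fact n)) * (\<Sum>n<N. shift_coeff s k n * ((t * y) ^ n / fact n)))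
      - (\<Sum>n<N. (t * x * y / l) ^ n / fact n))" for N
  proof -
    have pull: "(\<Sum>n<N. shift_coeff s k n * (c * g n)) = c * (\<Sum>n<N. shift_coeff s k n * g n)" for s k c and g :: "nat \<Rightarrow> real"
      by (simp add: sum_distrib_left mult_ac)
    have "(\<Sum>n<N. fact n / (l * t) ^ n * (p * ((t * x) ^ n / fact n)) * (q * ((t * y) ^ n / fact n)))
        = p * q * (\<Sum>n<N. (t * x * y / l) ^ n / fact n)"
      unfolding sum_distrib_left using l t by (intro sum.cong refl) (simp add: power_mult_distrib power_divide field_simps)
    moreover have "(\<Sum>k<N. w k * (p * a k) * (q * b k)) = p * q * (\<Sum>k<N. w k * a k * b k)" for w a b :: "nat \<Rightarrow> real"
      by (simp add: sum_distrib_left mult_ac)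
    ultimately show ?thesis
      unfolding bform_kac_form uv pull
      by (simp only: sum_distrib_left[symmetric] right_diff_distrib mult.assoc mult.left_commute[of l])
  qed
  have "(\<lambda>N. bform N (kac_form l N t) (coherent l t i) (coherent l t j)) \<longlonglongrightarrow>
    p * q * (l * (\<Sum>s\<in>{1, -1}. exp (s * (t * x + t * y) + (t * x) * (t * y) / t)) - exp (t * x * y / l))"
    unfolding eq using xy t by (intro tendsto_intros coherent_limit partial_exp_tendsto) auto
  also have "p * q * (l * (\<Sum>s\<in>{1, -1}. exp (s * (t * x + t * y) + (t * x) * (t * y) / t)) - exp (t * x * y / l))
      = coherent_gram l t i j"
    unfolding coherent_gram_def Let_def x_def[symmetric] y_def[symmetric] p_def q_def using t
    by (simp add: algebra_simps power2_eq_square flip: exp_add) (simp add: field_simps)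
  finally show ?thesis .
qed

lemma exp_decay: "0 < \<kappa> \<Longrightarrow> ((\<lambda>t::real. exp (- (t * \<kappa>))) \<longlongrightarrow> 0) at_top"
  by real_asymp

text \<open>Distinct centers make the first term decay off the diagonal. Centers at most
  \<open>l\<close> give \<open>x * y / l \<le> x\<close>, so the exponent of the subtracted term
  stays strictly negative.\<close>

lemma coherent_gram_tendsto:
  assumes l: "0 < l"
  shows "((\<lambda>t. coherent_gram l t i j) \<longlongrightarrow> l * of_bool (i = j)) at_top"
proof -
  define x where "x = center l i"
  define y where "y = center l j"
  have xy: "0 < x" "0 < y" "y \<le> l" using center_bounds[OF l] by (auto simp: x_def y_def)
  have 1: "((\<lambda>t. exp (- (t * ((x - y)\<^sup>2 / 2)))) \<longlongrightarrow> of_bool (i = j)) at_top"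
  proof (cases "i = j")
    case False
    then have "x \<noteq> y" using l by (auto simp: x_def y_def center_def field_simps)
    then show ?thesis using False exp_decay[of "(x - y)\<^sup>2 / 2"] by simp
  qed (simp add: x_def y_def)
  have 2: "((\<lambda>t. exp (- (t * ((x - y)\<^sup>2 / 2 + 2 * (x + y))))) \<longlongrightarrow> 0) at_top"
    using xy by (intro exp_decay add_nonneg_pos) auto
  have "x * y / l \<le> x" using xy l by (simp add: field_simps)
  then have 3: "((\<lambda>t. exp (- (t * ((x\<^sup>2 + y\<^sup>2) / 2 + x + y - x * y / l)))) \<longlongrightarrow> 0) at_top"
    using xy by (intro exp_decay) (smt (verit) divide_nonneg_nonneg zero_le_power2)
  have "((\<lambda>t. coherent_gram l t i j) \<longlongrightarrow> l * of_bool (i = j) + l * 0 - 0) at_top"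
    unfolding coherent_gram_def Let_def x_def[symmetric] y_def[symmetric]
    by (intro tendsto_intros 1 2 3)
  then show ?thesis by simp
qed

lemma kac_form_positive:
  assumes l: "0 < l"
  obtains t N where "c \<le> t" "posdim N (kac_form l N t) m"
proof -
  \<comment> \<open>One share of \<open>\<eta>\<close> pays for the limit in \<open>t\<close>, one
    for the limit in \<open>N\<close> at that \<open>t\<close>; together they stay within the margin
    of \<open>posdim_gram\<close>.\<close>
  define \<eta> where "\<eta> = l / (real m + 1) / 2"
  have "\<eta> + \<eta> = l / (real m + 1)" unfolding \<eta>_def by (rule field_sum_of_halves)
  then have \<eta>: "0 < \<eta>" "real m * (\<eta> + \<eta>) < l"
    using l by (simp_all add: \<eta>_def pos_divide_less_eq algebra_simps)
  have ev: "\<forall>\<^sub>F t in at_top. \<bar>coherent_gram l t i j - l * of_bool (i = j)\<bar> < \<eta>" for i j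
    using tendstoD[OF coherent_gram_tendsto[OF l] \<eta>(1)] by (simp add: dist_real_def)
  have "\<forall>\<^sub>F t in at_top. (\<forall>i\<in>{..<m}. \<forall>j\<in>{..<m}. \<bar>coherent_gram l t i j - l * of_bool (i = j)\<bar> < \<eta>) \<and> max c 1 \<le> t"
    by (intro eventually_conj eventually_ball_finite ballI eventually_ge_at_top ev finite_lessThan)
  then obtain t where "(\<forall>i\<in>{..<m}. \<forall>j\<in>{..<m}. \<bar>coherent_gram l t i j - l * of_bool (i = j)\<bar> < \<eta>) \<and> max c 1 \<le> t"
    using eventually_happens'[OF trivial_limit_at_top_linorder] by blast
  then have t: "\<And>i j. i < m \<Longrightarrow> j < m \<Longrightarrow> \<bar>coherent_gram l t i j - l * of_bool (i = j)\<bar> < \<eta>" "max c 1 \<le> t"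
    by blast+
  then have t0: "0 < t" by simp
  have ev': "\<forall>\<^sub>F N in sequentially. \<bar>bform N (kac_form l N t) (coherent l t i) (coherent l t j) - coherent_gram l t i j\<bar> < \<eta>" for i j
    using tendstoD[OF bform_coherent_tendsto[OF l t0] \<eta>(1)] by (simp add: dist_real_def)
  have "\<forall>\<^sub>F N in sequentially. \<forall>i\<in>{..<m}. \<forall>j\<in>{..<m}. \<bar>bform N (kac_form l N t) (coherent l t i) (coherent l t j) - coherent_gram l t i j\<bar> < \<eta>"
    by (intro eventually_ball_finite ballI ev' finite_lessThan)
  then obtain N where "\<forall>i\<in>{..<m}. \<forall>j\<in>{..<m}. \<bar>bform N (kac_form l N t) (coherent l t i) (coherent l t j) - coherent_gram l t i j\<bar> < \<eta>"
    unfolding eventually_sequentially by blast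
  then have N: "\<And>i j. i < m \<Longrightarrow> j < m \<Longrightarrow> \<bar>bform N (kac_form l N t) (coherent l t i) (coherent l t j) - coherent_gram l t i j\<bar> < \<eta>"
    by blast
  show thesis
  proof (rule that)
    show "c \<le> t" using t by simp
    show "posdim N (kac_form l N t) m"
    proof (rule posdim_gram[where u = "coherent l t", OF _ \<eta>(2)])
      show "\<bar>bform N (kac_form l N t) (coherent l t i) (coherent l t j) - l * of_bool (i = j)\<bar> \<le> \<eta> + \<eta>"
        if "i < m" "j < m" for i j
        using N[OF that] t(1)[OF that] by linarith
    qed
  qed
qed

section \<open>Limits of truncated eigenfunctions\<close>

text \<open>If y has coefficients \<open>v\<close>, this is f with y = S f, that is f(z) = y(z / l);
  hence the powers of \<open>l\<close>.\<close>

definition kac_poly :: "real \<Rightarrow> nat \<Rightarrow> (nat \<Rightarrow> real) \<Rightarrow> complex \<Rightarrow> complex"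
  where "kac_poly l N v z = (\<Sum>n<N. of_real (v n / l ^ n) * z ^ n)"

lemma holomorphic_ruelle_op:
  assumes "g holomorphic_on UNIV"
  shows "ruelle_op l \<beta> g holomorphic_on UNIV"
proof -
  have "(\<lambda>z. g (c + of_real l * z)) holomorphic_on UNIV" for c
    by (rule holomorphic_on_compose_gen[OF _ assms, unfolded o_def]) (auto intro!: holomorphic_intros)
  from this[of "of_real l"] this[of "- of_real l"] show ?thesis
    unfolding ruelle_op_def by (intro holomorphic_intros)
qed

lemma kac_poly_shift:
  assumes l: "0 < l"
  shows "kac_poly l N v (s * of_real l + of_real l * z) =
    (\<Sum>k<N. (\<Sum>n<N. of_nat (n choose k) * s ^ (n - k) * of_real (v n)) * z ^ k)"
proof -
  have "kac_poly l N v (s * of_real l + of_real l * z) = (\<Sum>n<N. of_real (v n) * (z + s) ^ n)"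
    unfolding kac_poly_def
  proof (intro sum.cong refl)
    fix n
    have "s * of_real l + of_real l * z = of_real l * (z + s)" by (simp add: algebra_simps)
    then show "of_real (v n / l ^ n) * (s * of_real l + of_real l * z) ^ n = of_real (v n) * (z + s) ^ n"
      using l by (simp add: power_mult_distrib)
  qed
  also have "\<dots> = (\<Sum>n<N. \<Sum>k<N. of_nat (n choose k) * s ^ (n - k) * of_real (v n) * z ^ k)"
  proof (intro sum.cong refl)
    fix n assume n: "n \<in> {..<N}"
    have "(z + s) ^ n = (\<Sum>k\<le>n. of_nat (n choose k) * z ^ k * s ^ (n - k))"
      by (rule binomial_ring)
    also have "\<dots> = (\<Sum>k<N. of_nat (n choose k) * z ^ k * s ^ (n - k))"
      using n by (intro sum.mono_neutral_left) auto
    finally show "of_real (v n) * (z + s) ^ n = (\<Sum>k<N. of_nat (n choose k) * s ^ (n - k) * of_real (v n) * z ^ k)"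
      by (simp add: sum_distrib_left mult_ac)
  qed
  also have "\<dots> = (\<Sum>k<N. (\<Sum>n<N. of_nat (n choose k) * s ^ (n - k) * of_real (v n)) * z ^ k)"
    unfolding sum_distrib_right by (rule sum.swap)
  finally show ?thesis .
qed

lemma exp_poly_fps:
  fixes d :: "nat \<Rightarrow> complex"
  shows "(\<lambda>z. exp (c * z) * (\<Sum>k<N. d k * z ^ k)) has_fps_expansion fps_exp c * (\<Sum>k<N. fps_const (d k) * fps_X ^ k)"
  by (intro fps_expansion_intros)

lemma exp_poly_fps_nth:
  fixes d :: "nat \<Rightarrow> complex"
  assumes "m < N"
  shows "fps_nth (fps_exp c * (\<Sum>k<N. fps_const (d k) * fps_X ^ k)) m = (\<Sum>k\<le>m. c ^ (m - k) / fact (m - k) * d k)"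
proof -
  have "fps_nth (\<Sum>k<N. fps_const (d k) * fps_X ^ k) i = d i" if "i < N" for i
    unfolding fps_sum_nth using that by (subst sum.remove[of _ i]) (auto intro!: sum.neutral)
  then have "fps_nth (fps_exp c * (\<Sum>k<N. fps_const (d k) * fps_X ^ k)) m = (\<Sum>i=0..m. c ^ i / fact i * d (m - i))"
    unfolding fps_mult_nth using assms by (intro sum.cong refl) auto
  also have "\<dots> = (\<Sum>k\<le>m. c ^ (m - k) / fact (m - k) * d k)"
    by (rule sum.reindex_bij_witness[of _ "\<lambda>k. m - k" "\<lambda>k. m - k"]) auto
  finally show ?thesis .
qed

text \<open>Row \<open>m\<close> of the kernel equation, multiplied by
  \<open>t ^ m / (l * fact m)\<close>, compares the Taylor coefficients of order \<open>m\<close> of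
  the image of f and of f / l. Agreement holds only below order \<open>N\<close>, as the image is
  not a polynomial.\<close>

lemma kac_kernel_taylor:
  fixes l t :: real
  assumes l: "0 < l" and t: "0 < t"
    and ker: "\<And>m. m < N \<Longrightarrow> (\<Sum>n<N. kac_form l N t m n * v n) = 0" and m: "m < N"
  shows "(deriv ^^ m) (ruelle_op l (of_real t) (kac_poly l N v)) 0 / fact m = of_real (v m / l ^ m / l)"
proof -
  define d where "d s k = (\<Sum>n<N. shift_coeff s k n * v n)" for s k
  have shift: "kac_poly l N v (of_real s * of_real l + of_real l * z) = (\<Sum>k<N. of_real (d s k) * z ^ k)" for s z
    unfolding kac_poly_shift[OF l] d_def by (simp add: shift_coeff_def)
  have op: "ruelle_op l (of_real t) (kac_poly l N v) =
      (\<lambda>z. exp (of_real t * z) * (\<Sum>k<N. of_real (d 1 k) * z ^ k) + exp (- of_real t * z) * (\<Sum>k<N. of_real (d (-1) k) * z ^ k))"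
    unfolding ruelle_op_def shift[symmetric] by simp
  let ?F = "\<lambda>s. fps_exp (of_real (s * t)) * (\<Sum>k<N. fps_const (of_real (d s k)) * fps_X ^ k) :: complex fps"
  have "ruelle_op l (of_real t) (kac_poly l N v) has_fps_expansion ?F 1 + ?F (-1)"
    unfolding op using exp_poly_fps[where c = "of_real (1 * t)" and N = N and d = "\<lambda>k. of_real (d 1 k)"]
      exp_poly_fps[where c = "of_real (- 1 * t)" and N = N and d = "\<lambda>k. of_real (d (- 1) k)"]
    by (intro has_fps_expansion_add) simp_all
  from fps_nth_fps_expansion[OF this, of m]
  have "(deriv ^^ m) (ruelle_op l (of_real t) (kac_poly l N v)) 0 / fact m = fps_nth (?F 1 + ?F (-1)) m"
    by simp
  also have "\<dots> = of_real (\<Sum>s\<in>{1, -1}. \<Sum>k\<le>m. (s * t) ^ (m - k) / fact (m - k) * d s k)"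
    by (simp add: exp_poly_fps_nth[OF m])
  also have "(\<Sum>s\<in>{1, -1}. \<Sum>k\<le>m. (s * t) ^ (m - k) / fact (m - k) * d s k) = v m / l ^ m / l"
  proof -
    \<comment> \<open>This is the adjointness of multiplication by \<open>exp (s * t * z)\<close>
      and translation by \<open>s\<close>, in coordinates.\<close>
    have k_sum: "(\<Sum>k\<le>m. (s * t) ^ (m - k) / fact (m - k) * d s k)
        = t ^ m / fact m * (\<Sum>k<N. fact k / t ^ k * shift_coeff s k m * d s k)" for s
    proof -
      have "(\<Sum>k<N. fact k / t ^ k * shift_coeff s k m * d s k) = (\<Sum>k\<le>m. fact k / t ^ k * shift_coeff s k m * d s k)"
        using m by (intro sum.mono_neutral_right) (auto simp: shift_coeff_def)
      moreover have "t ^ m / fact m * (fact k / t ^ k * shift_coeff s k m * d s k) = (s * t) ^ (m - k) / fact (m - k) * d s k"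
        if "k \<le> m" for k
        using t that by (simp add: shift_coeff_def binomial_fact power_mult_distrib power_diff field_simps)
      ultimately show ?thesis by (simp add: sum_distrib_left)
    qed
    have "0 = (\<Sum>n<N. kac_form l N t m n * v n)" using ker[OF m] by simp
    also have "\<dots> = l * (\<Sum>s\<in>{1, -1}. \<Sum>k<N. fact k / t ^ k * shift_coeff s k m * d s k) - fact m / (l * t) ^ m * v m"
    proof -
      have "(\<Sum>n<N. (if m = n then fact n / (l * t) ^ n else 0) * v n) = fact m / (l * t) ^ m * v m"
        using m by (subst sum.remove[of _ m]) auto
      moreover have "(\<Sum>n<N. (\<Sum>k<N. fact k / t ^ k * shift_coeff s k m * shift_coeff s k n) * v n)
          = (\<Sum>k<N. fact k / t ^ k * shift_coeff s k m * d s k)" for s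
        unfolding d_def sum_distrib_right sum_distrib_left by (subst sum.swap) (simp add: mult_ac)
      ultimately show ?thesis
        unfolding kac_form_def left_diff_distrib sum_subtractf
        by (simp add: distrib_left distrib_right sum.distrib mult.assoc sum_distrib_left[symmetric])
    qed
    finally have "l * (\<Sum>s\<in>{1, -1}. \<Sum>k<N. fact k / t ^ k * shift_coeff s k m * d s k) = fact m / (l * t) ^ m * v m"
      by simp
    then have "t ^ m / fact m * (\<Sum>s\<in>{1, -1}. \<Sum>k<N. fact k / t ^ k * shift_coeff s k m * d s k) = v m / l ^ m / l"
      using l t by (simp add: field_simps power_mult_distrib)
    then show ?thesis unfolding k_sum by (simp add: distrib_left)
  qed
  finally show ?thesis .
qed

text \<open>Cauchy's estimates on the larger disc of radius \<open>R\<close> make the tail geometric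
  with ratio \<open>r / R\<close>.\<close>

lemma taylor_remainder_le:
  fixes h :: "complex \<Rightarrow> complex"
  assumes hol: "h holomorphic_on UNIV" and B: "\<And>z. norm z \<le> R \<Longrightarrow> norm (h z) \<le> B"
    and r: "0 < r" "r < R" and z: "norm z \<le> r"
  shows "norm (h z - (\<Sum>m<N. (deriv ^^ m) h 0 / fact m * z ^ m)) \<le> B * R / (R - r) * (r / R) ^ N"
proof -
  define c where "c m = (deriv ^^ m) h 0 / fact m * z ^ m" for m
  have c: "norm (c m) \<le> B * (r / R) ^ m" for m
  proof -
    have "norm ((deriv ^^ m) h 0) \<le> fact m * B / R ^ m"
      using r hol B by (intro Cauchy_inequality)
        (auto intro: holomorphic_on_subset holomorphic_on_imp_continuous_on)
    then have "norm ((deriv ^^ m) h 0 / fact m) \<le> B / R ^ m"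
      by (simp add: norm_divide field_simps)
    then have "norm (c m) \<le> (B / R ^ m) * r ^ m"
      unfolding c_def norm_mult norm_power using z by (intro mult_mono power_mono) (auto intro: order_trans[rotated])
    then show ?thesis by (simp add: power_divide)
  qed
  have q: "0 < r / R" "r / R < 1" using r by auto
  have sumM: "summable (\<lambda>m. B * (r / R) ^ m)" using q by (intro summable_mult summable_geometric) auto
  have "c sums h z"
    using holomorphic_power_series[of h 0 R z] hol r z unfolding c_def by (auto intro: holomorphic_on_subset)
  then have "h z - (\<Sum>m<N. c m) = (\<Sum>m. c (m + N))"
    using suminf_minus_initial_segment[of c N] by (simp add: sums_iff)
  also have "norm \<dots> \<le> (\<Sum>m. B * (r / R) ^ (m + N))"
    using c sumM by (intro norm_suminf_le) (auto simp: summable_iff_shift[of "\<lambda>m. B * (r / R) ^ m"])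
  also have "\<dots> = (\<Sum>m. (B * (r / R) ^ N) * (r / R) ^ m)"
    by (simp add: power_add mult_ac)
  also have "\<dots> = B * (r / R) ^ N * (1 / (1 - r / R))"
    using q by (subst suminf_mult) (auto simp: suminf_geometric intro: summable_geometric)
  also have "1 / (1 - r / R) = R / (R - r)" using r by (simp add: field_simps)
  finally show ?thesis unfolding c_def by (simp add: mult_ac)
qed

text \<open>A bound on the disc of radius \<open>l * (1 + \<rho>)\<close> controls the image on
  radius \<open>\<rho>\<close>. With \<open>\<rho> = R\<close> this gives the Taylor remainder its
  room; with \<open>\<rho> = r\<close> it keeps the limit from vanishing.\<close>

lemma norm_ruelle_op_le:
  assumes l: "0 < l" and t: "0 \<le> t" "t \<le> b" and z: "norm z \<le> \<rho>"
    and g: "\<And>w. norm w \<le> l * (1 + \<rho>) \<Longrightarrow> norm (g w) \<le> M"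
  shows "norm (ruelle_op l (of_real t) g z) \<le> 2 * exp (b * \<rho>) * M"
proof -
  have M: "0 \<le> M" 
  proof -
    have "0 \<le> \<rho>" using z norm_ge_zero order_trans by blast
    then have "norm (g 0) \<le> M" using l by (intro g) auto
    then show ?thesis using norm_ge_zero order_trans by blast
  qed
  have e: "norm (exp (of_real s * of_real t * z)) \<le> exp (b * \<rho>)" if "s \<in> {1, -1}" for s :: real
  proof -
    have "norm (exp (of_real s * of_real t * z)) \<le> exp (norm (of_real s * of_real t :: complex) * norm z)"
      by (rule norm_exp_mult_le)
    also have "\<dots> \<le> exp (b * \<rho>)"
      using that t z by (auto simp: norm_mult intro!: mult_mono)
    finally show ?thesis .
  qed
  have 1: "norm (of_real l + of_real l * z) \<le> l * (1 + \<rho>)" "norm (- of_real l + of_real l * z) \<le> l * (1 + \<rho>)"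
    using norm_affine_branch_le[of l z \<rho> 1] norm_affine_branch_le[of l z \<rho> "-1"] l z by (simp_all add: add.commute)
  have "norm (ruelle_op l (of_real t) g z) \<le> exp (b * \<rho>) * M + exp (b * \<rho>) * M"
    unfolding ruelle_op_def
    by (intro order_trans[OF norm_triangle_ineq] add_mono, unfold norm_mult)
       (use e[of 1] e[of "-1"] g 1 M in \<open>auto intro!: mult_mono\<close>)
  then show ?thesis by (simp add: mult_ac)
qed

text \<open>A kernel polynomial scaled to supremum norm 1 solves the eigenvalue equation up to a
  Taylor remainder of order \<open>N\<close>. Its image is bounded on radius \<open>R\<close>
  because \<open>l * (1 + R) \<le> r\<close>; \<open>t\<close> enters the error only through
  \<open>b\<close>, so one bound serves the whole interval.\<close>

lemma approximate_eigenfunction: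
  fixes l r R a b t :: real
  assumes l: "0 < l" and t: "0 < t" "t \<le> b" and r: "0 < r" "r < R" "l * (1 + R) \<le> r"
    and deg: "\<not> nondegenerate N (kac_form l N t)"
  obtains f where "f holomorphic_on UNIV" "\<And>z. norm z \<le> r \<Longrightarrow> norm (f z) \<le> 1"
    "\<And>M. (\<And>z. norm z \<le> r \<Longrightarrow> norm (f z) \<le> M) \<Longrightarrow> 1 \<le> M"
    "\<And>z. norm z \<le> r \<Longrightarrow> norm (ruelle_op l (of_real t) f z - f z / of_real l) \<le> 2 * exp (b * R) * R / (R - r) * (r / R) ^ N"
proof -
  obtain v where ker: "\<And>m. m < N \<Longrightarrow> (\<Sum>n<N. kac_form l N t m n * v n) = 0" and "\<exists>j<N. v j \<noteq> 0"
    using deg unfolding nondegenerate_def by blast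
  then obtain j where j: "j < N" "v j \<noteq> 0" by blast
  have hol: "kac_poly l N v holomorphic_on UNIV" for v
    unfolding kac_poly_def by (intro holomorphic_intros)
  define D where "D = disc_norm r (kac_poly l N v)"
  have in_space: "kac_poly l N v \<in> disc_space r" by (rule holomorphic_in_disc_space[OF hol])
  have D0: "0 < D"
  proof (rule ccontr)
    assume "\<not> 0 < D"
    then have "D = 0" using disc_norm_nonneg[OF r(1) in_space] by (simp add: D_def)
    \<comment> \<open>A nonzero polynomial would have a whole disc of roots.\<close>
    then have "cball 0 r \<subseteq> {z. (\<Sum>n\<le>N - 1. of_real (v n / l ^ n) * z ^ n :: complex) = 0}"
      using norm_le_disc_norm[OF r(1) in_space] j unfolding D_def kac_poly_def
      by (cases N) (auto simp: lessThan_Suc_atMost)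
    moreover have "finite {z. (\<Sum>n\<le>N - 1. of_real (v n / l ^ n) * z ^ n :: complex) = 0}"
      unfolding polyfun_finite_roots using j l by (intro exI[of _ j]) auto
    ultimately have "finite (cball 0 r :: complex set)" by (rule finite_subset)
    then show False using uncountable_cball[OF r(1)] countable_finite by blast
  qed
  define w where "w n = v n / D" for n
  have kerw: "(\<Sum>n<N. kac_form l N t m n * w n) = 0" if "m < N" for m
    using ker[OF that] unfolding w_def times_divide_eq_right sum_divide_distrib[symmetric] by simp
  have scale: "kac_poly l N w z = kac_poly l N v z / of_real D" for z
    unfolding kac_poly_def w_def by (simp add: sum_divide_distrib mult_ac)
  define f where "f = kac_poly l N w"
  have f1: "norm (f z) \<le> 1" if "norm z \<le> r" for z
    using norm_le_disc_norm[OF r(1) in_space that] D0 unfolding f_def scale D_def[symmetric]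
    by (simp add: norm_divide)
  show thesis
  proof (rule that[of f])
    show "f holomorphic_on UNIV" unfolding f_def by (rule hol)
    show "norm (f z) \<le> 1" if "norm z \<le> r" for z by (rule f1[OF that])
    show "1 \<le> M" if M: "\<And>z. norm z \<le> r \<Longrightarrow> norm (f z) \<le> M" for M
    proof -
      have "norm (kac_poly l N v z) \<le> M * D" if "norm z \<le> r" for z
        using M[OF that] D0 unfolding f_def scale by (simp add: norm_divide field_simps)
      then have "D \<le> M * D" unfolding D_def by (intro disc_norm_bounds(2)[OF r(1)]) auto
      then show ?thesis using D0 by simp
    qed
    fix z :: complex assume z: "norm z \<le> r"
    let ?h = "ruelle_op l (of_real t) f"
    have "norm (?h z - (\<Sum>m<N. (deriv ^^ m) ?h 0 / fact m * z ^ m)) \<le> (2 * exp (b * R) * 1) * R / (R - r) * (r / R) ^ N"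
    proof (rule taylor_remainder_le[OF _ _ r(1,2) z])
      show "?h holomorphic_on UNIV" by (intro holomorphic_ruelle_op) (simp add: f_def hol)
      show "norm (?h z) \<le> 2 * exp (b * R) * 1" if "norm z \<le> R" for z
        using t r f1 by (intro norm_ruelle_op_le[OF l _ _ that]) auto
    qed
    also have "(\<Sum>m<N. (deriv ^^ m) ?h 0 / fact m * z ^ m) = f z / of_real l"
      unfolding f_def kac_poly_def sum_divide_distrib
      using kac_kernel_taylor[OF l t(1) kerw] unfolding kac_poly_def
      by (intro sum.cong refl) simp
    finally show "norm (?h z - f z / of_real l) \<le> 2 * exp (b * R) * R / (R - r) * (r / R) ^ N" by simp
  qed
qed

lemma limit_eigenfunction:
  fixes l r a b :: real
  assumes l: "0 < l" "l < 1" "l / (1 - l) < r" and a: "0 < a"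
    and deg: "\<And>N. N0 \<le> N \<Longrightarrow> \<exists>t\<in>{a..b}. \<not> nondegenerate N (kac_form l N t)"
  obtains t g w where "t \<in> {a..b}" "g \<in> disc_space r" "norm w \<le> r" "g w \<noteq> 0"
    "\<And>z. norm z \<le> r \<Longrightarrow> ruelle_op l (of_real t) g z = 1 / of_real l * g z"
proof -
  note r = ruelle_parameters[OF l]
  \<comment> \<open>The largest radius with \<open>l * (1 + R) \<le> r\<close>; it exceeds
    \<open>r\<close> because \<open>l * (1 + r) < r\<close>.\<close>
  define R where "R = r / l - 1"
  have R: "r < R" "l * (1 + R) \<le> r" using l r by (auto simp: R_def field_simps)
  define C where "C = 2 * exp (b * R) * R / (R - r)"
  have "\<forall>N. \<exists>t f. t \<in> {a..b} \<and> f holomorphic_on UNIV \<and> (\<forall>z. norm z \<le> r \<longrightarrow> norm (f z) \<le> 1)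
      \<and> (\<forall>M. (\<forall>z. norm z \<le> r \<longrightarrow> norm (f z) \<le> M) \<longrightarrow> 1 \<le> M)
      \<and> (\<forall>z. norm z \<le> r \<longrightarrow> norm (ruelle_op l (of_real t) f z - f z / of_real l) \<le> C * (r / R) ^ (N0 + N))"
  proof
    fix N
    obtain t where t: "t \<in> {a..b}" "\<not> nondegenerate (N0 + N) (kac_form l (N0 + N) t)"
      using deg[of "N0 + N"] by auto
    then have "0 < t" "t \<le> b" using a by auto
    from approximate_eigenfunction[OF l(1) this r(1) R t(2)] t(1)
    show "\<exists>t f. t \<in> {a..b} \<and> f holomorphic_on UNIV \<and> (\<forall>z. norm z \<le> r \<longrightarrow> norm (f z) \<le> 1)
      \<and> (\<forall>M. (\<forall>z. norm z \<le> r \<longrightarrow> norm (f z) \<le> M) \<longrightarrow> 1 \<le> M)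
      \<and> (\<forall>z. norm z \<le> r \<longrightarrow> norm (ruelle_op l (of_real t) f z - f z / of_real l) \<le> C * (r / R) ^ (N0 + N))"
      unfolding C_def by metis
  qed
  then obtain t f where t: "\<And>N. t N \<in> {a..b}" and hol: "\<And>N. f N holomorphic_on UNIV"
    and f1: "\<And>N z. norm z \<le> r \<Longrightarrow> norm (f N z) \<le> 1"
    and f_large: "\<And>N M. (\<And>z. norm z \<le> r \<Longrightarrow> norm (f N z) \<le> M) \<Longrightarrow> 1 \<le> M"
    and err: "\<And>N z. norm z \<le> r \<Longrightarrow> norm (ruelle_op l (of_real (t N)) (f N) z - f N z / of_real l) \<le> C * (r / R) ^ (N0 + N)"
    unfolding choice_iff by blast
  obtain \<tau> p where \<tau>: "\<tau> \<in> {a..b}" and p: "strict_mono p" "(t \<circ> p) \<longlonglongrightarrow> \<tau>"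
    using compact_Icc[of a b] t unfolding compact_def by blast
  obtain h q where h: "h holomorphic_on ball 0 r" and q: "strict_mono q"
    and ptw: "\<And>z. z \<in> ball 0 r \<Longrightarrow> (\<lambda>n. (f \<circ> p) (q n) z) \<longlonglongrightarrow> h z"
    and unif: "\<And>K. compact K \<Longrightarrow> K \<subseteq> ball 0 r \<Longrightarrow> uniform_limit K ((f \<circ> p) \<circ> q) h sequentially"
  proof (rule Montel[of "ball 0 r" "range (f \<circ> p)" "f \<circ> p"])
    show "\<exists>B. \<forall>h\<in>range (f \<circ> p). \<forall>z\<in>K. norm (h z) \<le> B" if "compact K" "K \<subseteq> ball 0 r" for K
      using that f1 by (intro exI[of _ 1]) (fastforce simp: less_imp_le)
  qed (auto intro: holomorphic_on_subset[OF hol])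
  define u where "u n = p (q n)" for n
  have u: "strict_mono u" unfolding u_def using p(1) q by (simp add: strict_mono_def)
  have tu: "(\<lambda>n. t (u n)) \<longlonglongrightarrow> \<tau>"
    using LIMSEQ_subseq_LIMSEQ[OF p(2) q] by (simp add: o_def u_def)
  have fu: "(\<lambda>n. f (u n) z) \<longlonglongrightarrow> h z" if "norm z < r" for z
    using ptw[of z] that by (simp add: u_def)
  define E where "E n = C * (r / R) ^ (N0 + u n)" for n
  have E: "E \<longlonglongrightarrow> 0"
  proof -
    have "filterlim (\<lambda>n. N0 + u n) sequentially sequentially"
      using filterlim_subseq[OF u] by (intro filterlim_at_top_mono[OF filterlim_subseq[OF u]]) auto
    then have "(\<lambda>n. C * (r / R) ^ (N0 + u n)) \<longlonglongrightarrow> C * 0"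
      using r R by (intro tendsto_mult_left filterlim_compose[OF LIMSEQ_realpow_zero]) auto
    then show ?thesis by (simp add: E_def[abs_def])
  qed
  have inner: "norm (of_real l * z + s * of_real l) < r" if "norm z \<le> r" "norm s = 1" for z s :: complex
    using norm_affine_branch_le[of l z r s] that l r by simp
  have branch: "norm (of_real l + of_real l * z) < r" "norm (- of_real l + of_real l * z) < r" if "norm z \<le> r" for z :: complex
    using inner[OF that, of 1] inner[OF that, of "-1"] by (simp_all add: add.commute)
  \<comment> \<open>The Montel limit \<open>h\<close> is controlled only on the open disc. Both
    branches send the closed disc into the open one, so this expression is continuous up to the
    boundary and equals \<open>h\<close> inside.\<close>
  define g where "g z = of_real l * ruelle_op l (of_real \<tau>) h z" for z
  have fg: "(\<lambda>n. f (u n) z) \<longlonglongrightarrow> g z" if z: "norm z \<le> r" for z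
  proof -
    have lim: "(\<lambda>n. ruelle_op l (of_real (t (u n))) (f (u n)) z) \<longlonglongrightarrow> ruelle_op l (of_real \<tau>) h z"
      unfolding ruelle_op_def by (intro tendsto_intros fu branch[OF z] tu)
    have "(\<lambda>n. ruelle_op l (of_real (t (u n))) (f (u n)) z - f (u n) z / of_real l) \<longlonglongrightarrow> 0"
      by (rule Lim_null_comparison[OF _ E]) (use err[OF z] in \<open>auto simp: E_def\<close>)
    from tendsto_mult_left[OF tendsto_diff[OF lim this], of "of_real l"]
    show ?thesis using l by (simp add: g_def)
  qed
  have gh: "g z = h z" if "norm z < r" for z
    using LIMSEQ_unique[OF fg fu] that by simp
  have g_in: "g \<in> disc_space r"
  proof -
    have comp: "(\<lambda>z. h (c + of_real l * z)) holomorphic_on ball 0 r"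
      "continuous_on (cball 0 r) (\<lambda>z. h (c + of_real l * z))"
      if c: "\<And>z. norm z \<le> r \<Longrightarrow> norm (c + of_real l * z) < r" for c
    proof -
      show "(\<lambda>z. h (c + of_real l * z)) holomorphic_on ball 0 r"
        by (rule holomorphic_on_compose_gen[OF _ h, unfolded o_def]) (use c in \<open>auto intro!: holomorphic_intros\<close>)
      show "continuous_on (cball 0 r) (\<lambda>z. h (c + of_real l * z))"
        by (rule continuous_on_compose2[OF holomorphic_on_imp_continuous_on[OF h]])
          (use c in \<open>auto intro!: continuous_intros\<close>)
    qed
    show ?thesis unfolding disc_space_def g_def ruelle_op_def
      using comp[OF branch(1)] comp[OF branch(2)] by (auto intro!: holomorphic_intros continuous_intros)
  qed
  have eigen: "ruelle_op l (of_real \<tau>) g z = 1 / of_real l * g z" if "norm z \<le> r" for z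
  proof -
    have "ruelle_op l (of_real \<tau>) g z = ruelle_op l (of_real \<tau>) h z"
      unfolding ruelle_op_def using branch[OF that] by (simp add: gh)
    then show ?thesis using l by (simp add: g_def)
  qed
  have "\<exists>w. norm w \<le> r \<and> g w \<noteq> 0"
  proof (rule ccontr)
    assume "\<not> ?thesis"
    then have h0: "h z = 0" if "norm z < r" for z using gh that by (metis less_imp_le)
    let ?K = "cball 0 (l * (1 + r)) :: complex set"
    \<comment> \<open>If \<open>h\<close> vanished, the polynomials would be eventually below
      \<open>\<epsilon>\<close> on the smaller disc. This value makes \<open>l\<close> times their
      images at most 1/4 on the full disc; with an error below 1/2 the supremum norm could not be
      1.\<close>
    define \<epsilon> where "\<epsilon> = 1 / (8 * l * exp (b * r))"
    have \<epsilon>: "0 < \<epsilon>" using l by (simp add: \<epsilon>_def)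
    have "uniform_limit ?K ((f \<circ> p) \<circ> q) h sequentially"
      using r by (intro unif) auto
    then have "\<forall>\<^sub>F n in sequentially. \<forall>z\<in>?K. dist (f (u n) z) (h z) < \<epsilon>"
      using \<epsilon> by (auto simp: uniform_limit_iff u_def)
    moreover have "\<forall>\<^sub>F n in sequentially. E n < 1 / (2 * l)"
      using E l by (intro order_tendstoD(2)[OF E]) auto
    ultimately have "\<forall>\<^sub>F n in sequentially. (\<forall>z\<in>?K. dist (f (u n) z) (h z) < \<epsilon>) \<and> E n < 1 / (2 * l)"
      by (rule eventually_conj)
    then obtain n where n: "\<And>z. norm z \<le> l * (1 + r) \<Longrightarrow> dist (f (u n) z) (h z) < \<epsilon>" "E n < 1 / (2 * l)"
      unfolding eventually_sequentially by (metis mem_cball_0 order_refl)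
    have small: "norm (f (u n) z) \<le> \<epsilon>" if "norm z \<le> l * (1 + r)" for z
      using n(1)[OF that] h0[of z] that r by simp
    have "norm (f (u n) z) \<le> 1 / 4 + l * E n" if z: "norm z \<le> r" for z
    proof -
      have "norm (ruelle_op l (of_real (t (u n))) (f (u n)) z) \<le> 2 * exp (b * r) * \<epsilon>"
        using t[of "u n"] a by (intro norm_ruelle_op_le[OF l(1) _ _ z small]) auto
      also have "\<dots> = 1 / (4 * l)" by (simp add: \<epsilon>_def)
      finally have "norm (f (u n) z / of_real l) \<le> 1 / (4 * l) + E n"
        using err[OF z, of "u n"] norm_triangle_sub[of "f (u n) z / of_real l" "ruelle_op l (of_real (t (u n))) (f (u n)) z"]
        by (simp add: E_def norm_minus_commute)
      then have "norm (f (u n) z) / l \<le> 1 / (4 * l) + E n" using l by (simp add: norm_divide)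
      then show ?thesis using l by (simp add: field_simps)
    qed
    then have "1 \<le> 1 / 4 + l * E n" by (rule f_large)
    moreover have "l * E n < 1 / 2" using n(2) l by (simp add: field_simps)
    ultimately show False by simp
  qed
  then show thesis using that[OF \<tau> g_in _ _ eigen] by blast
qed

text \<open>The order of choices matters: \<open>a\<close> lies beyond all supposed zeros,
  \<open>k\<close> bounds the index at \<open>a\<close> for every large degree, and only then is
  \<open>b\<close> taken so large that the index there exceeds \<open>k\<close>.\<close>

theorem infinite_real_zeros:
  fixes l r :: real
  assumes l: "0 < l" "l < 1" "l / (1 - l) < r"
  shows "infinite {\<beta>::real. fredholm_det r (ruelle_op l (of_real \<beta>)) (of_real l) = 0}" (is "infinite ?Z")
proof
  assume fin: "finite ?Z"
  obtain B where B: "\<And>\<beta>. \<beta> \<in> ?Z \<Longrightarrow> \<beta> \<le> B"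
    using bdd_above_finite[OF fin] unfolding bdd_above_def by blast
  define a where "a = max 1 (B + 1)"
  have a: "0 < a" "B < a" by (auto simp: a_def)
  obtain k where neg: "\<And>N. k \<le> N \<Longrightarrow> posdim N (\<lambda>i j. - kac_form l N a i j) (N - k)"
    using kac_form_negative[OF l(1,2) a(1)] by blast
  obtain b N1 where b: "a \<le> b" and pos: "posdim N1 (kac_form l N1 b) (Suc k)"
    using kac_form_positive[OF l(1), of a "Suc k"] by blast
  have "\<exists>t\<in>{a..b}. \<not> nondegenerate N (kac_form l N t)" if N: "max k N1 \<le> N" for N
  proof (rule inertia_crossing[where a = a and b = b and k = k and m = "Suc k"])
    show "continuous_on {a..b} (\<lambda>t. kac_form l N t i j)" for i j
      using a by (intro continuous_on_subset[OF continuous_on_kac_form[OF l(1)]]) auto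
    show "posdim N (kac_form l N b) (Suc k)" using kac_form_mono[OF pos] N by simp
    show "posdim N (\<lambda>i j. - kac_form l N a i j) (N - k)" using neg N by simp
  qed (use b N in \<open>auto intro: kac_form_sym\<close>)
  then obtain t g w where t: "t \<in> {a..b}" and g: "g \<in> disc_space r" "norm w \<le> r" "g w \<noteq> 0"
    and eigen: "\<And>z. norm z \<le> r \<Longrightarrow> ruelle_op l (of_real t) g z = 1 / of_real l * g z"
    using limit_eigenfunction[OF l a(1)] by blast
  have "fredholm_det r (ruelle_op l (of_real t)) (1 / (1 / of_real l)) = 0"
    using l by (intro fredholm_det_ruelle_eigenvalue[OF l g(1) eigen g(2,3)]) auto
  then have "t \<in> ?Z" by simp
  then show False using B t a by fastforce
qed

theorem proposition5p2:
  fixes l r :: real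
  assumes "0 < l" and "l < 1" and "l / (1 - l) < r"
  shows "infinite {\<beta>::real. fredholm_det r (ruelle_op l (of_real \<beta>)) (of_real l) = 0} \<and>
         (l = 1 / 2 \<longrightarrow>
           infinite {\<beta>::complex. Re \<beta> = ln 2 \<and> fredholm_det r (ruelle_op l \<beta>) (of_real l) = 0})"
proof (intro conjI impI)
  assume half: "l = 1 / 2"
  have "1 < r" using assms unfolding half by simp
  from infinite_zeros_half[OF this]
  show "infinite {\<beta>::complex. Re \<beta> = ln 2 \<and> fredholm_det r (ruelle_op l \<beta>) (of_real l) = 0}"
    unfolding half .
qed (rule infinite_real_zeros[OF assms])

end
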